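(* Let $G$ be a graph, $d\colon V(G)\to\mathbb N$, and $k\ge1$ an integer. The following are equivalent: (1) $\mathrm{tw}(G,d)\le k-1$; (2) $\mathrm{moncw}(G,d)\le k$; (3) $\mathrm{cw}(G,d)\le k$. In particular, every first order formula $\varphi$ satisfies $\mathrm{fotw}(\varphi)+1=\mathrm{moncw}(G_\varphi,\mathrm{ead}_\varphi)=\mathrm{cw}(G_\varphi,\mathrm{ead}_\varphi)$.
   Context: Cops and robber game on $G$ with $k$ cops: the cops first occupy a set $X_0\subseteq V(G)$ with $|X_0|\le k$ and the robber picks a vertex not in $X_0$. In each round, if the cops occupy $X$ and the robber is on $r$, the cops announce a new set $Y$ with $|Y|\le k$; the robber then moves to any vertex $r'$ of the connected component of $G\setminus(X\cap Y)$ containing $r$; then the cops occupy $Y$. The cops win if the robber ends on a vertex of $Y$ (is captured); the robber wins if she is never captured. The robber space at a position with cop set $X$ and robber vertex $r$ is the connected component of $G\setminus X$ containing $r$. In the $d$-stratified game the cops must additionally ensure at every position with cop set $X$ and robber space $R$ that $\max\{d(x):x\in X\}\le\min\{d(r):r\in R\}$. A winning strategy for the cops is monotone if in every play consistent with it the sequence of robber spaces is decreasing w.r.t. $\subseteq$. $\mathrm{cw}(G,d)$ (resp. $\mathrm{moncw}(G,d)$) is the minimum $k$ such that $k$ cops have a winning strategy (resp. a monotone winning strategy) in the $d$-stratified game on $G$. A tree decomposition $(T,B)$ of $G$ (rooted tree $T$, pieces $B_t\subseteq V(G)$ covering all vertices and edges, $\{t:v\in B_t\}$ connected for each $v$; width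 $\max|B_t|-1$) is $d$-stratified if $t_u<_Tt_v$ implies $d(u)\le d(v)$, where $<_T$ is the tree order with root smallest and $t_v$ the $<_T$-minimal node whose piece contains $v$; $\mathrm{tw}(G,d)$ is the minimum width of such a decomposition. For formulae (relational first-order, negation normal form, straight: no variable quantified twice, no free variable also quantified, quantified variables occur in atoms): $G_\varphi$ has vertex set $\mathrm{var}(\varphi)$ and edges between distinct variables both free or co-occurring in an atom; for bound $x$, $Q_x$ is its quantifier and its scope the $\psi$ with $Q_xx\psi$ a subformula; $x\le_\varphi y$ iff $x=y$ or $y$ is quantified in the scope of $x$; $\varphi_{[X]}$ is the minimal subformula containing all atoms using variables from $X$; $x,y$ are entangled w.r.t. $\trianglelefteq$ if $x$ occurs in $\varphi_{[\{z:y\trianglelefteq z\}]}$ and $y$ in $\varphi_{[\{z:x\trianglelefteq z\}]}$; $\preceq_\varphi$ is the smallest reflexive transitive relation such that if $x\le_\varphi y$, $Q_x\ne Q_y$ and there is a sequence $x=z_0,\dots,z_n=y$ of bound variables with $z_i,z_{i+1}$ entangled w.r.t. $\preceq_\varphi$ and ($x\preceq_\varphi z_i$ or $y\preceq_\varphi z_i$) for all $i<n$, then $x\preceq_\varphi y$; $\mathrm{ead}_\varphi(x)=0$ for free $x$, and for bound $x$ the maximum over sequences $v_1,\dots,v_m=x$ with $v_i\preceq_\varphi v_{i+1}$, $v_i\ne v_{i+1}$ of the number of quantifier changes $Q_{v_i}\ne Q_{v_{i+1}}$, plus 1 if $Q_{v_1}=\exists$, plus 2 if $Q_{v_1}=\forall$;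 $\mathrm{fotw}(\varphi):=\mathrm{tw}(G_\varphi,\mathrm{ead}_\varphi)$. *)

theory Defs
  imports "Graph_Theory.Digraph_Component" "HOL-Library.Sublist"
begin

section \<open>The stratified cops and robber game\<close>

text \<open>
  Finite simple undirected graphs are the \<open>pair_graph\<close>s of the graph library: finite, loop-free
  and with a symmetric set of arcs.

  The connected component of \<open>G\<close> without \<open>X\<close> that contains \<open>r\<close>. It is empty if \<open>r\<close> lies in \<open>X\<close>,
  since \<open>reachable\<close> forces its end points into the vertex set.
\<close>

definition component_without :: "'a pair_pre_digraph \<Rightarrow> 'a set \<Rightarrow> 'a \<Rightarrow> 'a set" where
  "component_without G X r = {v. reachable (with_proj G \<restriction> (pverts G - X)) r v}"

text \<open>
  A position is a pair of a cop set and a robber vertex; it is a captured position if the vertex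
  lies in the set.
\<close>

type_synonym 'a position = "'a set \<times> 'a"

definition captured :: "'a position \<Rightarrow> bool" where
  "captured P \<longleftrightarrow> snd P \<in> fst P"

definition robber_space :: "'a pair_pre_digraph \<Rightarrow> 'a position \<Rightarrow> 'a set" where
  "robber_space G P = component_without G (fst P) (snd P)"

text \<open>
  A strategy maps the list of all positions seen so far, the current one last, to the cop set
  announced next; the value at the empty list is the initial cop set.
\<close>

type_synonym 'a cop_strategy = "'a position list \<Rightarrow> 'a set"

inductive play :: "'a pair_pre_digraph \<Rightarrow> 'a cop_strategy \<Rightarrow> 'a position list \<Rightarrow> bool"
  for G :: "'a pair_pre_digraph" and \<sigma> :: "'a cop_strategy" where
  play_init: "r \<in> pverts G - \<sigma> [] \<Longrightarrow> play G \<sigma> [(\<sigma> [], r)]"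
| play_step: "\<lbrakk>play G \<sigma> (ps @ [(X, r)]); \<not> captured (X, r); Y = \<sigma> (ps @ [(X, r)]);
      r' \<in> component_without G (X \<inter> Y) r\<rbrakk>
    \<Longrightarrow> play G \<sigma> (ps @ [(X, r), (Y, r')])"

definition infinite_play :: "'a pair_pre_digraph \<Rightarrow> 'a cop_strategy \<Rightarrow> (nat \<Rightarrow> 'a position) \<Rightarrow> bool" where
  "infinite_play G \<sigma> p \<longleftrightarrow> (\<forall>n. play G \<sigma> (map p [0..<Suc n]))"

definition strategy_for :: "'a pair_pre_digraph \<Rightarrow> nat \<Rightarrow> 'a cop_strategy \<Rightarrow> bool" where
  "strategy_for G k \<sigma> \<longleftrightarrow> (\<forall>ps. \<sigma> ps \<subseteq> pverts G \<and> card (\<sigma> ps) \<le> k)"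

text \<open>
  This is \<open>max {d x | x \<in> X} \<le> min {d r | r \<in> R}\<close> for the cop set \<open>X\<close> and the robber space \<open>R\<close>,
  read as true if \<open>X\<close> is empty or the robber is captured.
\<close>

definition stratified_position :: "'a pair_pre_digraph \<Rightarrow> ('a \<Rightarrow> nat) \<Rightarrow> 'a position \<Rightarrow> bool" where
  "stratified_position G d P \<longleftrightarrow> (\<forall>x \<in> fst P. \<forall>r \<in> robber_space G P. d x \<le> d r)"

text \<open>
  A play stops when the robber is captured, and otherwise she always has a move (she may stay).
  Hence the cops win every play consistent with the strategy iff there is no infinite one.
\<close>

definition winning_strategy ::
    "'a pair_pre_digraph \<Rightarrow> ('a \<Rightarrow> nat) \<Rightarrow> nat \<Rightarrow> 'a cop_strategy \<Rightarrow> bool" where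
  "winning_strategy G d k \<sigma> \<longleftrightarrow>
     strategy_for G k \<sigma> \<and>
     (\<forall>ps. play G \<sigma> ps \<longrightarrow> (\<forall>P \<in> set ps. stratified_position G d P)) \<and>
     \<not> (\<exists>p. infinite_play G \<sigma> p)"

definition monotone_strategy :: "'a pair_pre_digraph \<Rightarrow> 'a cop_strategy \<Rightarrow> bool" where
  "monotone_strategy G \<sigma> \<longleftrightarrow>
     (\<forall>ps. play G \<sigma> ps \<longrightarrow>
        (\<forall>i. Suc i < length ps \<longrightarrow> robber_space G (ps ! Suc i) \<subseteq> robber_space G (ps ! i)))"

definition cw :: "'a pair_pre_digraph \<Rightarrow> ('a \<Rightarrow> nat) \<Rightarrow> nat" where
  "cw G d = (LEAST k. \<exists>\<sigma>. winning_strategy G d k \<sigma>)"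

definition moncw :: "'a pair_pre_digraph \<Rightarrow> ('a \<Rightarrow> nat) \<Rightarrow> nat" where
  "moncw G d = (LEAST k. \<exists>\<sigma>. winning_strategy G d k \<sigma> \<and> monotone_strategy G \<sigma>)"


section \<open>Stratified tree decompositions\<close>

text \<open>
  A finite rooted tree is given with its edges oriented away from the root: from the root there is
  exactly one directed walk to every node. The tree order is then reachability.
\<close>

definition rooted_tree :: "'t pair_pre_digraph \<Rightarrow> 't \<Rightarrow> bool" where
  "rooted_tree T r \<longleftrightarrow>
     pair_fin_digraph T \<and> r \<in> pverts T \<and>
     (\<forall>t \<in> pverts T. \<exists>!p. pre_digraph.awalk (with_proj T) r p t)"

definition tree_less :: "'t pair_pre_digraph \<Rightarrow> 't \<Rightarrow> 't \<Rightarrow> bool" where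
  "tree_less T s t \<longleftrightarrow> reachable (with_proj T) s t \<and> s \<noteq> t"

text \<open>\<open>connected\<close> of the graph library refers to the underlying undirected graph.\<close>

definition tree_decomposition ::
    "'a pair_pre_digraph \<Rightarrow> 't pair_pre_digraph \<Rightarrow> 't \<Rightarrow> ('t \<Rightarrow> 'a set) \<Rightarrow> bool" where
  "tree_decomposition G T r B \<longleftrightarrow>
     rooted_tree T r \<and>
     (\<forall>t \<in> pverts T. B t \<subseteq> pverts G) \<and>
     (\<forall>v \<in> pverts G. \<exists>t \<in> pverts T. v \<in> B t) \<and>
     (\<forall>(u, v) \<in> parcs G. \<exists>t \<in> pverts T. u \<in> B t \<and> v \<in> B t) \<and>
     (\<forall>v \<in> pverts G. Digraph_Component.connected (with_proj T \<restriction> {t \<in> pverts T. v \<in> B t}))"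

definition width :: "'t pair_pre_digraph \<Rightarrow> ('t \<Rightarrow> 'a set) \<Rightarrow> int" where
  "width T B = int (Max ((\<lambda>t. card (B t)) ` pverts T)) - 1"

definition top_node :: "'t pair_pre_digraph \<Rightarrow> ('t \<Rightarrow> 'a set) \<Rightarrow> 'a \<Rightarrow> 't" where
  "top_node T B v = (THE t. t \<in> pverts T \<and> v \<in> B t \<and>
     \<not> (\<exists>s \<in> pverts T. v \<in> B s \<and> tree_less T s t))"

definition stratified_decomposition ::
    "'a pair_pre_digraph \<Rightarrow> ('a \<Rightarrow> nat) \<Rightarrow> 't pair_pre_digraph \<Rightarrow> ('t \<Rightarrow> 'a set) \<Rightarrow> bool" where
  "stratified_decomposition G d T B \<longleftrightarrow>
     (\<forall>u \<in> pverts G. \<forall>v \<in> pverts G.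
        tree_less T (top_node T B u) (top_node T B v) \<longrightarrow> d u \<le> d v)"

text \<open>
  Every finite tree is isomorphic to one with nodes in \<open>nat\<close>. Widths are integers because the
  empty graph has tree-width \<open>-1\<close>.
\<close>

definition tw :: "'a pair_pre_digraph \<Rightarrow> ('a \<Rightarrow> nat) \<Rightarrow> int" where
  "tw G d = (LEAST w. \<exists>(T :: nat pair_pre_digraph) r B.
     tree_decomposition G T r B \<and> stratified_decomposition G d T B \<and> width T B = w)"


section \<open>First order formulae\<close>

text \<open>
  Relational formulae in negation normal form. A relation symbol is a name together with the
  length of its argument list, and nullary symbols are allowed. The
  Boolean of a literal is its sign.
\<close>

datatype quantifier = Exists | Forall

datatype ('r, 'v) atom = Rel 'r "'v list" | Eq 'v 'v

datatype ('r, 'v) fm =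
    Lit bool "('r, 'v) atom"
  | And "('r, 'v) fm" "('r, 'v) fm"
  | Or "('r, 'v) fm" "('r, 'v) fm"
  | Quant quantifier 'v "('r, 'v) fm"

primrec atom_vars :: "('r, 'v) atom \<Rightarrow> 'v set" where
  "atom_vars (Rel R xs) = set xs"
| "atom_vars (Eq x y) = {x, y}"

primrec vars :: "('r, 'v) fm \<Rightarrow> 'v set" where
  "vars (Lit s a) = atom_vars a"
| "vars (And \<phi> \<psi>) = vars \<phi> \<union> vars \<psi>"
| "vars (Or \<phi> \<psi>) = vars \<phi> \<union> vars \<psi>"
| "vars (Quant q x \<phi>) = insert x (vars \<phi>)"

primrec free_vars :: "('r, 'v) fm \<Rightarrow> 'v set" where
  "free_vars (Lit s a) = atom_vars a"
| "free_vars (And \<phi> \<psi>) = free_vars \<phi> \<union> free_vars \<psi>"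
| "free_vars (Or \<phi> \<psi>) = free_vars \<phi> \<union> free_vars \<psi>"
| "free_vars (Quant q x \<phi>) = free_vars \<phi> - {x}"

text \<open>
  Occurrences of subformulae, each with its address in the syntax tree: the occurrence at \<open>p\<close>
  contains the one at \<open>q\<close> iff \<open>p\<close> is a prefix of \<open>q\<close>.
\<close>

primrec occs :: "('r, 'v) fm \<Rightarrow> (nat list \<times> ('r, 'v) fm) set" where
  "occs (Lit s a) = {([], Lit s a)}"
| "occs (And \<phi> \<psi>) = {([], And \<phi> \<psi>)} \<union>
     {(0 # p, \<chi>) | p \<chi>. (p, \<chi>) \<in> occs \<phi>} \<union> {(1 # p, \<chi>) | p \<chi>. (p, \<chi>) \<in> occs \<psi>}"
| "occs (Or \<phi> \<psi>) = {([], Or \<phi> \<psi>)} \<union>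
     {(0 # p, \<chi>) | p \<chi>. (p, \<chi>) \<in> occs \<phi>} \<union> {(1 # p, \<chi>) | p \<chi>. (p, \<chi>) \<in> occs \<psi>}"
| "occs (Quant q x \<phi>) = {([], Quant q x \<phi>)} \<union> {(0 # p, \<chi>) | p \<chi>. (p, \<chi>) \<in> occs \<phi>}"

definition atoms :: "('r, 'v) fm \<Rightarrow> ('r, 'v) atom set" where
  "atoms \<phi> = {a. \<exists>p s. (p, Lit s a) \<in> occs \<phi>}"

definition bound_vars :: "('r, 'v) fm \<Rightarrow> 'v set" where
  "bound_vars \<phi> = {x. \<exists>p q \<psi>. (p, Quant q x \<psi>) \<in> occs \<phi>}"

definition straight :: "('r, 'v) fm \<Rightarrow> bool" where
  "straight \<phi> \<longleftrightarrow>
     (\<forall>x p q \<psi> p' q' \<psi>'.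
        (p, Quant q x \<psi>) \<in> occs \<phi> \<and> (p', Quant q' x \<psi>') \<in> occs \<phi> \<longrightarrow> p = p') \<and>
     free_vars \<phi> \<inter> bound_vars \<phi> = {} \<and>
     (\<forall>x \<in> bound_vars \<phi>. \<exists>a \<in> atoms \<phi>. x \<in> atom_vars a)"

definition formula_graph :: "('r, 'v) fm \<Rightarrow> 'v pair_pre_digraph" where
  "formula_graph \<phi> = \<lparr> pverts = vars \<phi>,
     parcs = {(x, y). x \<noteq> y \<and>
       (x \<in> free_vars \<phi> \<and> y \<in> free_vars \<phi> \<or>
        (\<exists>a \<in> atoms \<phi>. x \<in> atom_vars a \<and> y \<in> atom_vars a))} \<rparr>"

definition quant_of :: "('r, 'v) fm \<Rightarrow> 'v \<Rightarrow> quantifier" where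
  "quant_of \<phi> x = (THE q. \<exists>p \<psi>. (p, Quant q x \<psi>) \<in> occs \<phi>)"

definition scope_le :: "('r, 'v) fm \<Rightarrow> 'v \<Rightarrow> 'v \<Rightarrow> bool" where
  "scope_le \<phi> x y \<longleftrightarrow>
     x = y \<or> (\<exists>p q \<psi>. (p, Quant q x \<psi>) \<in> occs \<phi> \<and> y \<in> bound_vars \<psi>)"

definition contains_atoms_of :: "('r, 'v) fm \<Rightarrow> 'v set \<Rightarrow> nat list \<Rightarrow> bool" where
  "contains_atoms_of \<phi> X p \<longleftrightarrow>
     (\<forall>q s a. (q, Lit s a) \<in> occs \<phi> \<and> atom_vars a \<inter> X \<noteq> {} \<longrightarrow> prefix p q)"

text \<open>
  Unspecified if no atom of \<open>\<phi>\<close> uses a variable from \<open>X\<close>; below, \<open>X\<close> always contains a variable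
  that occurs in an atom.
\<close>

definition min_subformula :: "('r, 'v) fm \<Rightarrow> 'v set \<Rightarrow> ('r, 'v) fm" where
  "min_subformula \<phi> X = (THE \<psi>. \<exists>p. (p, \<psi>) \<in> occs \<phi> \<and> contains_atoms_of \<phi> X p \<and>
     (\<forall>p' \<psi>'. (p', \<psi>') \<in> occs \<phi> \<and> contains_atoms_of \<phi> X p' \<longrightarrow> prefix p' p))"

definition entangled :: "('r, 'v) fm \<Rightarrow> 'v rel \<Rightarrow> 'v \<Rightarrow> 'v \<Rightarrow> bool" where
  "entangled \<phi> R x y \<longleftrightarrow>
     x \<in> vars (min_subformula \<phi> {z. (y, z) \<in> R}) \<and>
     y \<in> vars (min_subformula \<phi> {z. (x, z) \<in> R})"

definition dependence_closed :: "('r, 'v) fm \<Rightarrow> 'v rel \<Rightarrow> bool" where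
  "dependence_closed \<phi> R \<longleftrightarrow>
     R \<subseteq> vars \<phi> \<times> vars \<phi> \<and> refl_on (vars \<phi>) R \<and> trans R \<and>
     (\<forall>x \<in> bound_vars \<phi>. \<forall>y \<in> bound_vars \<phi>.
        scope_le \<phi> x y \<and> quant_of \<phi> x \<noteq> quant_of \<phi> y \<and>
        (\<exists>zs. zs \<noteq> [] \<and> hd zs = x \<and> last zs = y \<and> set zs \<subseteq> bound_vars \<phi> \<and>
           (\<forall>i. Suc i < length zs \<longrightarrow>
              entangled \<phi> R (zs ! i) (zs ! Suc i) \<and> ((x, zs ! i) \<in> R \<or> (y, zs ! i) \<in> R)))
        \<longrightarrow> (x, y) \<in> R)"

text \<open>
  The closure condition is monotone in the relation, so the intersection of all closed relations
  is the smallest one.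
\<close>

definition dependence :: "('r, 'v) fm \<Rightarrow> 'v rel" where
  "dependence \<phi> = \<Inter> {R. dependence_closed \<phi> R}"

definition quantifier_changes :: "('r, 'v) fm \<Rightarrow> 'v list \<Rightarrow> nat" where
  "quantifier_changes \<phi> vs =
     card {i. Suc i < length vs \<and> quant_of \<phi> (vs ! i) \<noteq> quant_of \<phi> (vs ! Suc i)}"

definition dependence_chain :: "('r, 'v) fm \<Rightarrow> 'v list \<Rightarrow> bool" where
  "dependence_chain \<phi> vs \<longleftrightarrow> vs \<noteq> [] \<and> set vs \<subseteq> bound_vars \<phi> \<and>
     (\<forall>i. Suc i < length vs \<longrightarrow> (vs ! i, vs ! Suc i) \<in> dependence \<phi> \<and> vs ! i \<noteq> vs ! Suc i)"

definition ead :: "('r, 'v) fm \<Rightarrow> 'v \<Rightarrow> nat" where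
  "ead \<phi> x = (if x \<in> bound_vars \<phi>
     then Max {quantifier_changes \<phi> vs + (case quant_of \<phi> (hd vs) of Exists \<Rightarrow> 1 | Forall \<Rightarrow> 2) | vs.
                 dependence_chain \<phi> vs \<and> last vs = x}
     else 0)"

definition fotw :: "('r, 'v) fm \<Rightarrow> int" where
  "fotw \<phi> = tw (formula_graph \<phi>) (ead \<phi>)"

end

theory Submission
  imports Defs
begin

text \<open>
  Stratification decouples the levels of \<open>d\<close>. Call a connected set \<open>C\<close> an upper part if all its
  neighbours lie on strictly smaller levels than all its vertices, and form its torso: keep the
  lowest level of \<open>C\<close> and the neighbours of \<open>C\<close>, make the latter a clique, and replace each
  component of the higher levels of \<open>C\<close> by a clique on its neighbours. Ordinary tree decompositions
  of all torsos glue to a stratified tree decomposition of the graph, because each of these cliques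
  lies in a bag. If some torso has tree-width at least \<open>k\<close>, it has a bramble that no \<open>k\<close> vertices
  cover, and the robber evades by staying in a bramble set free of cops: a torso edge that is not an
  edge is a detour through vertices on which the cops cannot stand without violating stratification.

  The duality between brambles and tree-width follows Bellenbaum and Diestel, with Menger's
  theorem replaced by a direct comparison of a bag with a minimum cover of the bramble. Conversely,
  a stratified tree decomposition tells the cops how to chase the robber down the tree monotonically.
\<close>

subsection \<open>Connected sets and components\<close>

text \<open>A winning strategy need not be monotone, so no tree can be read off it directly. It is
  therefore used only to bound covers of brambles, and duality builds the tree. Torsos reduce the
  stratified problem to the ordinary one because they have a single free level: apart from the
  neighbours of \<open>C\<close>, all torso vertices lie on the bottom level of \<open>C\<close>.
  The neighbours form a clique, so some bag holds them all; rooted at that bag, any tree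
  decomposition of the torso is stratified. Since the level drop at the border of an upper part is
  strict, the components above its bottom level are upper parts again, and the construction
  recurses. The delicate torso edges are those of the clique on the neighbours of \<open>C\<close>.
  Unlike the levels above the bottom, \<open>C\<close> itself may hold cops, who may block the
  detour. Such a cop is illegal once the robber's space contains a neighbour of \<open>C\<close>;
  exploiting this takes both the current position and the possible next ones. The number
  \<open>k\<close> bounds cops and bag sizes alike, which is why the width is one less.\<close>

definition cut_connected :: "('a \<Rightarrow> 'a \<Rightarrow> bool) \<Rightarrow> 'a set \<Rightarrow> bool" where
  "cut_connected E U \<longleftrightarrow> (\<forall>A \<subseteq> U. A \<noteq> {} \<and> A \<noteq> U \<longrightarrow> (\<exists>a \<in> A. \<exists>b \<in> U - A. E a b))"

definition neighbours :: "('a \<Rightarrow> 'a \<Rightarrow> bool) \<Rightarrow> 'a set \<Rightarrow> 'a set" where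
  "neighbours E C = {v. v \<notin> C \<and> (\<exists>u \<in> C. E u v)}"

definition component_of :: "('a \<Rightarrow> 'a \<Rightarrow> bool) \<Rightarrow> 'a set \<Rightarrow> 'a \<Rightarrow> 'a set" where
  "component_of E S v = \<Union> {U. U \<subseteq> S \<and> v \<in> U \<and> cut_connected E U}"

definition components :: "('a \<Rightarrow> 'a \<Rightarrow> bool) \<Rightarrow> 'a set \<Rightarrow> 'a set set" where
  "components E S = component_of E S ` S"

lemma cut_connectedD:
  assumes "cut_connected E U" "A \<inter> U \<noteq> {}" "\<not> U \<subseteq> A"
  obtains a b where "a \<in> U \<inter> A" "b \<in> U - A" "E a b"
proof -
  have "\<exists>a \<in> U \<inter> A. \<exists>b \<in> U - U \<inter> A. E a b"
    using assms unfolding cut_connected_def by (metis Int_commute Int_lower1 inf.absorb_iff1)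
  then show thesis using that by blast
qed

lemma cut_connectedI:
  assumes "\<And>A. A \<subseteq> U \<Longrightarrow> A \<noteq> {} \<Longrightarrow> (\<And>a b. a \<in> A \<Longrightarrow> b \<in> U \<Longrightarrow> E a b \<Longrightarrow> b \<in> A) \<Longrightarrow> U \<subseteq> A"
  shows "cut_connected E U"
  unfolding cut_connected_def using assms by (metis DiffI subset_antisym)

text \<open>Connectivity is stated by cuts so that this rule can replace induction along paths: to
  place a connected set inside a region that it meets, it suffices that no edge within the set
  leaves the region.\<close>

lemma cut_connected_closed:
  assumes "cut_connected E U" "A \<inter> U \<noteq> {}" "\<And>a b. a \<in> A \<Longrightarrow> a \<in> U \<Longrightarrow> b \<in> U \<Longrightarrow> E a b \<Longrightarrow> b \<in> A"
  shows "U \<subseteq> A"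
  using assms by (metis DiffD1 DiffD2 IntD1 IntD2 cut_connectedD)

lemma cut_connected_singleton: "cut_connected E {v}"
  unfolding cut_connected_def by auto

lemma cut_connected_Union:
  assumes "\<And>U. U \<in> \<U> \<Longrightarrow> v \<in> U" "\<And>U. U \<in> \<U> \<Longrightarrow> cut_connected E U"
    and sym: "\<And>a b. E a b \<Longrightarrow> E b a"
  shows "cut_connected E (\<Union>\<U>)"
proof (rule cut_connectedI)
  fix A assume A: "A \<subseteq> \<Union>\<U>" "A \<noteq> {}" "\<And>a b. a \<in> A \<Longrightarrow> b \<in> \<Union>\<U> \<Longrightarrow> E a b \<Longrightarrow> b \<in> A"
  have in_A: "U \<subseteq> A" if "U \<in> \<U>" "A \<inter> U \<noteq> {}" for U
    using cut_connected_closed[OF assms(2)[OF that(1)] that(2)] A(3) that(1) by blast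
  obtain U where "U \<in> \<U>" "A \<inter> U \<noteq> {}" using A(1,2) by blast
  then have "v \<in> A" using in_A assms(1) by blast
  then have "U \<subseteq> A" if "U \<in> \<U>" for U using in_A assms(1) that by blast
  then show "\<Union>\<U> \<subseteq> A" by blast
qed

lemma cut_connected_Un:
  assumes "cut_connected E U" "cut_connected E U'" and sym: "\<And>a b. E a b \<Longrightarrow> E b a"
    and touch: "U \<inter> U' \<noteq> {} \<or> (\<exists>a \<in> U. \<exists>b \<in> U'. E a b)"
  shows "cut_connected E (U \<union> U')"
proof (rule cut_connectedI)
  fix A assume A: "A \<subseteq> U \<union> U'" "A \<noteq> {}" "\<And>a b. a \<in> A \<Longrightarrow> b \<in> U \<union> U' \<Longrightarrow> E a b \<Longrightarrow> b \<in> A"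
  have "U \<subseteq> A" if "A \<inter> U \<noteq> {}" using cut_connected_closed[OF assms(1) that] A(3) by blast
  moreover have "U' \<subseteq> A" if "A \<inter> U' \<noteq> {}" using cut_connected_closed[OF assms(2) that] A(3) by blast
  moreover have "A \<inter> U \<noteq> {} \<or> A \<inter> U' \<noteq> {}" using A by blast
  ultimately show "U \<union> U' \<subseteq> A" using touch A(3) sym by blast
qed

context
  fixes E :: "'a \<Rightarrow> 'a \<Rightarrow> bool"
  assumes sym: "\<And>a b. E a b \<Longrightarrow> E b a"
begin

lemma component_of_subset: "component_of E S v \<subseteq> S"
  unfolding component_of_def by blast

lemma component_of_self: "v \<in> S \<Longrightarrow> v \<in> component_of E S v"
  unfolding component_of_def by (rule UnionI[of "{v}"]) (auto simp: cut_connected_singleton)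

lemma component_of_connected: "cut_connected E (component_of E S v)"
  unfolding component_of_def by (rule cut_connected_Union) (use sym in auto)

text \<open>Joining \<open>U\<close> to the component gives a connected subset of \<open>S\<close>
  through \<open>v\<close>, hence one of the sets in the defining union. The adjacency alternative,
  applied to a singleton, yields \<open>neighbours_component\<close>.\<close>

lemma component_of_maximal:
  assumes "U \<subseteq> S" "cut_connected E U" "U \<inter> component_of E S v \<noteq> {} \<or>
    (\<exists>a \<in> component_of E S v. \<exists>b \<in> U. E a b)"
  shows "U \<subseteq> component_of E S v"
proof -
  let ?K = "component_of E S v"
  have "cut_connected E (?K \<union> U)"
    by (rule cut_connected_Un) (use assms component_of_connected sym in auto)
  moreover have "v \<in> ?K"
    using assms(3) unfolding component_of_def by blast
  ultimately have "?K \<union> U \<in> {U. U \<subseteq> S \<and> v \<in> U \<and> cut_connected E U}"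
    using assms(1) component_of_subset by blast
  then show ?thesis unfolding component_of_def by blast
qed

lemma Union_components: "\<Union> (components E S) = S"
proof
  show "\<Union> (components E S) \<subseteq> S" unfolding components_def using component_of_subset by blast
  show "S \<subseteq> \<Union> (components E S)" unfolding components_def using component_of_self by blast
qed

lemma component_nonempty: "C \<in> components E S \<Longrightarrow> C \<noteq> {}"
  unfolding components_def using component_of_self by blast

lemma component_connected: "C \<in> components E S \<Longrightarrow> cut_connected E C"
  unfolding components_def using component_of_connected by blast

lemma component_subset: "C \<in> components E S \<Longrightarrow> C \<subseteq> S"
  unfolding components_def using component_of_subset by blast

lemma neighbours_component:
  assumes "C \<in> components E S"
  shows "neighbours E C \<inter> S = {}"
proof (rule ccontr)
  assume "neighbours E C \<inter> S \<noteq> {}"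
  then obtain a b where ab: "b \<in> S" "b \<notin> C" "a \<in> C" "E a b" unfolding neighbours_def by blast
  moreover obtain v where "C = component_of E S v" using assms unfolding components_def by blast
  ultimately show False
    using component_of_maximal[of "{b}" S v] cut_connected_singleton[of E b] by blast
qed

lemma components_disjoint:
  assumes "C \<in> components E S" "D \<in> components E S" "C \<noteq> D"
  shows "C \<inter> D = {}"
proof (rule ccontr)
  assume "C \<inter> D \<noteq> {}"
  moreover obtain u v where uv: "C = component_of E S u" "D = component_of E S v"
    using assms unfolding components_def by blast
  ultimately have "C \<subseteq> D" "D \<subseteq> C"
    using component_of_maximal[of C S v] component_of_maximal[of D S u] component_of_subset
      component_of_connected by blast+
  then show False using assms by blast
qed

end

lemma finite_components: "finite S \<Longrightarrow> finite (components E S)"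
  unfolding components_def by blast

subsection \<open>Tree decompositions as terms\<close>

text \<open>
  \<open>decomp E F X W\<close>: the graph induced by \<open>E\<close> on \<open>W\<close> has a tree decomposition with bags \<open>F\<close> and
  root bag \<open>X\<close>; the second rule makes the root of one decomposition a child of the root of another.
\<close>

inductive decomp :: "('a \<Rightarrow> 'a \<Rightarrow> bool) \<Rightarrow> 'a set set \<Rightarrow> 'a set \<Rightarrow> 'a set \<Rightarrow> bool"
  for E :: "'a \<Rightarrow> 'a \<Rightarrow> bool" where
  leaf: "decomp E {X} X X"
| attach: "\<lbrakk>decomp E F X W; decomp E F' Y W'; W \<inter> W' \<subseteq> X; W \<inter> W' \<subseteq> Y;
    \<And>a b. a \<in> W - W' \<Longrightarrow> b \<in> W' - W \<Longrightarrow> \<not> E a b\<rbrakk> \<Longrightarrow> decomp E (F \<union> F') X (W \<union> W')"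

lemma decomp_root: "decomp E F X W \<Longrightarrow> X \<in> F"
  by (induction rule: decomp.induct) auto

lemma decomp_bag_subset: "decomp E F X W \<Longrightarrow> S \<in> F \<Longrightarrow> S \<subseteq> W"
  by (induction rule: decomp.induct) auto

text \<open>The rule \<open>attach\<close> works at the root only. Here the new tree is pushed into
  whichever half owns the bag \<open>Z\<close>; the shared vertices lie in \<open>Z\<close> and so
  in that half, which lets the two halves be joined again at their old place.\<close>

lemma decomp_attach_anywhere:
  assumes "decomp E F X W" "Z \<in> F" "decomp E F' Y W'" "W \<inter> W' \<subseteq> Z" "W \<inter> W' \<subseteq> Y"
    and "\<And>a b. a \<in> W - W' \<Longrightarrow> b \<in> W' - W \<Longrightarrow> \<not> E a b" and sym: "\<And>a b. E a b \<Longrightarrow> E b a"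
  shows "decomp E (F \<union> F') X (W \<union> W')"
  using assms(1,2,4-6)
proof (induction rule: decomp.induct)
  case (leaf X)
  then show ?case using decomp.attach[OF decomp.leaf assms(3)] by auto
next
  case (attach F1 X W1 F2 Y2 W2)
  show ?case
  proof (cases "Z \<in> F1")
    case True
    then have Z: "Z \<subseteq> W1" using attach.hyps decomp_bag_subset by metis
    have "decomp E (F1 \<union> F') X (W1 \<union> W')"
    proof (rule attach.IH(1)[OF True])
      show "\<not> E a b" if "a \<in> W1 - W'" "b \<in> W' - W1" for a b
        using that Z attach.hyps(5)[of a b] attach.prems(2) attach.prems(4)[of a b] by blast
    qed (use attach.prems in blast)+
    then have "decomp E ((F1 \<union> F') \<union> F2) X ((W1 \<union> W') \<union> W2)"
    proof (rule decomp.attach[OF _ attach.hyps(2)])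
      show "\<not> E a b" if "a \<in> W1 \<union> W' - W2" "b \<in> W2 - (W1 \<union> W')" for a b
        using that attach.hyps(5)[of a b] attach.prems(4)[of b a] sym[of a b] by blast
    qed (use attach.prems attach.hyps(3,4) Z in blast)+
    then show ?thesis by (simp add: Un_ac)
  next
    case False
    then have Z2: "Z \<in> F2" using attach.prems by blast
    then have Z: "Z \<subseteq> W2" using attach.hyps decomp_bag_subset by metis
    have "decomp E (F2 \<union> F') Y2 (W2 \<union> W')"
    proof (rule attach.IH(2)[OF Z2])
      show "\<not> E a b" if "a \<in> W2 - W'" "b \<in> W' - W2" for a b
        using that Z attach.prems(2) attach.prems(4)[of a b] by blast
    qed (use attach.prems in blast)+
    then have "decomp E (F1 \<union> (F2 \<union> F')) X (W1 \<union> (W2 \<union> W'))"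
    proof (rule decomp.attach[OF attach.hyps(1)])
      show "\<not> E a b" if "a \<in> W1 - (W2 \<union> W')" "b \<in> W2 \<union> W' - W1" for a b
        using that attach.hyps(5)[of a b] attach.prems(4)[of a b] by blast
    qed (use attach.prems attach.hyps(3,4) Z in blast)+
    then show ?thesis by (simp add: Un_ac)
  qed
qed

text \<open>If the new root is in the first half, the second half must hang at \<open>X\<close>, by
  then an inner bag; otherwise the first half hangs at \<open>Y\<close>. Both cases need attachment
  at an arbitrary bag.\<close>

lemma decomp_reroot:
  assumes "decomp E F X W" "S \<in> F" and sym: "\<And>a b. E a b \<Longrightarrow> E b a"
  shows "decomp E F S W"
  using assms(1,2)
proof (induction rule: decomp.induct)
  case (leaf X)
  then show ?case using decomp.leaf by simp
next
  case (attach F1 X W1 F2 Y W2)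
  show ?case
  proof (cases "S \<in> F1")
    case True
    show ?thesis
      by (rule decomp_attach_anywhere[OF attach.IH(1)[OF True] decomp_root[OF attach.hyps(1)]
            attach.hyps(2-5) sym])
  next
    case False
    then have S: "S \<in> F2" using attach.prems by blast
    have "decomp E (F2 \<union> F1) S (W2 \<union> W1)"
      by (rule decomp_attach_anywhere[OF attach.IH(2)[OF S] decomp_root[OF attach.hyps(2)]
            attach.hyps(1)]) (use attach.hyps sym in blast)+
    then show ?thesis by (simp add: Un_ac)
  qed
qed

text \<open>A clique with vertices strictly on both sides of an attachment would contain a forbidden
  edge, so it descends into one half at a time until it reaches a leaf.\<close>

lemma decomp_clique_in_bag:
  assumes "decomp E F X W" "K \<subseteq> W" "\<And>a b. a \<in> K \<Longrightarrow> b \<in> K \<Longrightarrow> a \<noteq> b \<Longrightarrow> E a b"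
  shows "\<exists>Z \<in> F. K \<subseteq> Z"
  using assms
proof (induction rule: decomp.induct)
  case (attach F X W F' Y W')
  consider "K \<subseteq> W" | "K \<subseteq> W'" | a b where "a \<in> K - W'" "b \<in> K - W" by blast
  then show ?case
  proof cases
    case 3
    then show ?thesis using attach.hyps(5)[of a b] attach.prems by blast
  qed (use attach.IH attach.prems(2) in blast)+
qed auto

lemma decomp_attach_family:
  assumes "finite \<C>" "decomp E F0 X X"
    and "\<And>C. C \<in> \<C> \<Longrightarrow> decomp E (F C) X (X \<union> C)"
    and "\<And>C D a b. C \<in> \<C> \<Longrightarrow> D \<in> \<C> \<Longrightarrow> C \<noteq> D \<Longrightarrow> a \<in> C \<Longrightarrow> b \<in> D \<Longrightarrow> \<not> E a b \<and> a \<noteq> b"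
  shows "decomp E (F0 \<union> \<Union> (F ` \<C>)) X (X \<union> \<Union>\<C>)"
  using assms(1,3,4)
proof (induction rule: finite_induct)
  case empty
  then show ?case using assms(2) by simp
next
  case (insert C \<C>)
  have "decomp E (F0 \<union> \<Union> (F ` \<C>)) X (X \<union> \<Union>\<C>)" using insert by (metis insertCI)
  moreover have "decomp E (F C) X (X \<union> C)" using insert by blast
  ultimately have "decomp E ((F0 \<union> \<Union> (F ` \<C>)) \<union> F C) X ((X \<union> \<Union>\<C>) \<union> (X \<union> C))"
  proof (rule decomp.attach)
    have *: "\<not> E a b \<and> a \<noteq> b" if "a \<in> \<Union>\<C>" "b \<in> C" for a b
    proof -
      obtain D where "D \<in> \<C>" "a \<in> D" using \<open>a \<in> \<Union>\<C>\<close> by blast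
      then show ?thesis using insert.prems(2)[of D C a b] insert.hyps that by blast
    qed
    then show "(X \<union> \<Union>\<C>) \<inter> (X \<union> C) \<subseteq> X" "(X \<union> \<Union>\<C>) \<inter> (X \<union> C) \<subseteq> X" by blast+
    show "\<not> E a b" if "a \<in> X \<union> \<Union>\<C> - (X \<union> C)" "b \<in> X \<union> C - (X \<union> \<Union>\<C>)" for a b
      using * that by blast
  qed
  then show ?case by (simp add: Un_ac)
qed

text \<open>
  Read \<open>S\<close> as the root bag of a decomposition of \<open>V\<close>. Every bag \<open>B\<close> is replaced by its part in \<open>C\<close>
  together with all vertices of \<open>X\<close> that occur at or below \<open>B\<close>, so that the new root contains \<open>X\<close>.
  In the induction \<open>W'\<close> is what lies at or below the current root in the whole tree; it may exceed
  \<open>W\<close> because the children of a node are attached one at a time.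
\<close>

lemma decomp_restrict:
  assumes "decomp E F R W" "W \<subseteq> W'" "W' \<subseteq> V" "X \<inter> C = {}"
    and "\<And>a b. a \<in> W' - R \<Longrightarrow> b \<in> V - W' \<Longrightarrow> \<not> E a b"
    and "\<And>a b. a \<in> W - R \<Longrightarrow> b \<in> W' - W \<Longrightarrow> \<not> E a b"
    and "S \<inter> W' \<subseteq> R"
    and sym: "\<And>a b. E a b \<Longrightarrow> E b a"
  shows "\<exists>F'. decomp E F' ((R \<inter> C) \<union> (X \<inter> W')) ((W \<inter> C) \<union> (X \<inter> W')) \<and>
    (\<forall>T \<in> F'. \<exists>B \<in> F. \<exists>U. T = (B \<inter> C) \<union> (X \<inter> U) \<and> B \<subseteq> U \<and> U \<subseteq> V \<and> S \<inter> U \<subseteq> B \<and>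
      (\<forall>a \<in> U - B. \<forall>b \<in> V - U. \<not> E a b))"
  using assms(1-3,5-7)
proof (induction arbitrary: W' rule: decomp.induct)
  case (leaf R)
  then show ?case
    by (intro exI[of _ "{(R \<inter> C) \<union> (X \<inter> W')}"] conjI decomp.leaf ballI bexI[of _ R] exI[of _ W'])
      auto
next
  case (attach F1 R W1 F2 Y W2)
  have "Y \<subseteq> W2" "R \<subseteq> W1" using attach.hyps decomp_bag_subset decomp_root by metis+
  note sub = this
  obtain G1 where G1: "decomp E G1 ((R \<inter> C) \<union> (X \<inter> W')) ((W1 \<inter> C) \<union> (X \<inter> W'))"
    "\<forall>T \<in> G1. \<exists>B \<in> F1. \<exists>U. T = (B \<inter> C) \<union> (X \<inter> U) \<and> B \<subseteq> U \<and> U \<subseteq> V \<and> S \<inter> U \<subseteq> B \<and>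
      (\<forall>a \<in> U - B. \<forall>b \<in> V - U. \<not> E a b)"
  proof (atomize_elim, rule attach.IH(1)[of W'])
    show "\<not> E a b" if "a \<in> W1 - R" "b \<in> W' - W1" for a b
      using that attach.hyps(3,5) attach.prems(4)[of a b] by blast
  qed (use attach.prems(1-3,5) in blast)+
  obtain G2 where G2: "decomp E G2 ((Y \<inter> C) \<union> (X \<inter> W2)) ((W2 \<inter> C) \<union> (X \<inter> W2))"
    "\<forall>T \<in> G2. \<exists>B \<in> F2. \<exists>U. T = (B \<inter> C) \<union> (X \<inter> U) \<and> B \<subseteq> U \<and> U \<subseteq> V \<and> S \<inter> U \<subseteq> B \<and>
      (\<forall>a \<in> U - B. \<forall>b \<in> V - U. \<not> E a b)"
  \<comment> \<open>The first half keeps the current root, so its territory stays \<open>W'\<close>.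
    All children of \<open>Y\<close> are already attached, so what lies at or below \<open>Y\<close>
    is exactly \<open>W2\<close>.\<close>
  proof (atomize_elim, rule attach.IH(2)[of W2])
    show "\<not> E a b" if "a \<in> W2 - Y" "b \<in> V - W2" for a b
    proof -
      have a: "a \<notin> W1" "a \<in> W'" "a \<notin> R" using that attach.hyps(4) attach.prems(1) sub by blast+
      show ?thesis
        using a that attach.hyps(5)[of b a] attach.prems(3)[of a b] attach.prems(4)[of a b] sym[of a b]
        by blast
    qed
    show "S \<inter> W2 \<subseteq> Y" using attach.prems(1,5) sub attach.hyps(4) by blast
  qed (use attach.prems(1,2) in blast)+
  have "decomp E (G1 \<union> G2) ((R \<inter> C) \<union> (X \<inter> W'))
    (((W1 \<inter> C) \<union> (X \<inter> W')) \<union> ((W2 \<inter> C) \<union> (X \<inter> W2)))"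
  proof (rule decomp.attach[OF G1(1) G2(1)])
    show "\<not> E a b" if "a \<in> W1 \<inter> C \<union> X \<inter> W' - (W2 \<inter> C \<union> X \<inter> W2)"
      "b \<in> W2 \<inter> C \<union> X \<inter> W2 - (W1 \<inter> C \<union> X \<inter> W')" for a b
    proof -
      have b: "b \<in> W2 - W1" "b \<in> W2 - R" using that attach.prems(1) sub by blast+
      show ?thesis
        using that b attach.hyps(5)[of a b] attach.prems(4)[of b a] sym[of a b] by blast
    qed
  qed (use attach.prems(1) attach.hyps(3,4) \<open>X \<inter> C = {}\<close> in blast)+
  moreover have "((W1 \<inter> C) \<union> (X \<inter> W')) \<union> ((W2 \<inter> C) \<union> (X \<inter> W2)) = ((W1 \<union> W2) \<inter> C) \<union> (X \<inter> W')"
    using attach.prems(1) by blast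
  ultimately have "decomp E (G1 \<union> G2) ((R \<inter> C) \<union> (X \<inter> W')) (((W1 \<union> W2) \<inter> C) \<union> (X \<inter> W'))"
    by simp
  then show ?case
    by (rule exI[of _ "G1 \<union> G2", OF conjI]) (metis G1(2) G2(2) UnCI UnE)
qed

subsection \<open>Brambles\<close>

definition touching :: "('a \<Rightarrow> 'a \<Rightarrow> bool) \<Rightarrow> 'a set \<Rightarrow> 'a set \<Rightarrow> bool" where
  "touching E U U' \<longleftrightarrow> U \<inter> U' \<noteq> {} \<or> (\<exists>a \<in> U. \<exists>b \<in> U'. E a b)"

definition bramble :: "('a \<Rightarrow> 'a \<Rightarrow> bool) \<Rightarrow> 'a set \<Rightarrow> 'a set set \<Rightarrow> bool" where
  "bramble E V \<B> \<longleftrightarrow> \<B> \<subseteq> Pow V \<and> (\<forall>U \<in> \<B>. U \<noteq> {} \<and> cut_connected E U) \<and>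
     (\<forall>U \<in> \<B>. \<forall>U' \<in> \<B>. touching E U U')"

definition covers :: "'a set \<Rightarrow> 'a set set \<Rightarrow> bool" where
  "covers X \<B> \<longleftrightarrow> (\<forall>U \<in> \<B>. X \<inter> U \<noteq> {})"

lemma touching_sym: "touching E U U' \<Longrightarrow> (\<And>a b. E a b \<Longrightarrow> E b a) \<Longrightarrow> touching E U' U"
  unfolding touching_def by (metis Int_commute)

text \<open>Restricting to \<open>C\<close> turns a bag \<open>B\<close> into
  \<open>(B \<inter> C) \<union> (X \<inter> W)\<close>, trading \<open>B - C\<close> for
  \<open>X \<inter> W\<close>. The opposite trade in the minimum cover \<open>X\<close> gives
  \<open>Z\<close>, again a cover, so \<open>X \<inter> W\<close> is no larger than
  \<open>B - C\<close> and no bag grows. A new bag above size \<open>k\<close> thus comes from an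
  old one above size \<open>k\<close>, and the bramble set missed by the old bag is missed by the
  new one too.\<close>

lemma bramble_decomp_step:
  assumes fin: "finite V" and sym: "\<And>a b. E a b \<Longrightarrow> E b a"
    and B: "bramble E V \<B>" and X: "X \<subseteq> V" "covers X \<B>" "card X \<le> k"
    and X_min: "\<And>Z. Z \<subseteq> V \<Longrightarrow> covers Z \<B> \<Longrightarrow> card X \<le> card Z"
    and C: "C \<subseteq> V - X" "neighbours E C \<inter> V \<subseteq> X"
    and F: "decomp E F S V" "\<forall>T \<in> F. k < card T \<longrightarrow> \<not> covers T (insert C \<B>)"
    and S: "covers S \<B>" "S \<inter> C = {}"
  shows "\<exists>F. decomp E F X (X \<union> C) \<and> (\<forall>T \<in> F. k < card T \<longrightarrow> \<not> covers T \<B>)"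
proof -
  have disj: "X \<inter> C = {}" using C by blast
  have eqs: "(S \<inter> C) \<union> (X \<inter> V) = X" "(V \<inter> C) \<union> (X \<inter> V) = X \<union> C"
    using S(2) C X(1) by blast+
  have "\<exists>F'. decomp E F' ((S \<inter> C) \<union> (X \<inter> V)) ((V \<inter> C) \<union> (X \<inter> V)) \<and>
    (\<forall>T \<in> F'. \<exists>B \<in> F. \<exists>W. T = (B \<inter> C) \<union> (X \<inter> W) \<and> B \<subseteq> W \<and> W \<subseteq> V \<and> S \<inter> W \<subseteq> B \<and>
      (\<forall>a \<in> W - B. \<forall>b \<in> V - W. \<not> E a b))"
    by (rule decomp_restrict[OF F(1) order_refl order_refl disj _ _ _ sym]) auto
  then obtain F' where F': "decomp E F' X (X \<union> C)"
    "\<forall>T \<in> F'. \<exists>B \<in> F. \<exists>W. T = (B \<inter> C) \<union> (X \<inter> W) \<and> B \<subseteq> W \<and> W \<subseteq> V \<and> S \<inter> W \<subseteq> B \<and>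
      (\<forall>a \<in> W - B. \<forall>b \<in> V - W. \<not> E a b)"
    unfolding eqs by (elim exE conjE)
  have "\<not> covers T \<B>" if T: "T \<in> F'" "k < card T" for T
  proof -
    from bspec[OF F'(2) T(1)] obtain B W where BW: "B \<in> F" "T = (B \<inter> C) \<union> (X \<inter> W)" "B \<subseteq> W" "W \<subseteq> V"
      "S \<inter> W \<subseteq> B" and sep: "\<forall>a \<in> W - B. \<forall>b \<in> V - W. \<not> E a b"
      by (elim bexE exE conjE)
    have finite: "finite X" "finite W" "finite B" "finite C"
      by (rule finite_subset[OF _ fin], use X(1) BW(3,4) C(1) in blast)+
    define Z where "Z = (B - C) \<union> (X - W)"
    \<comment> \<open>\<open>Z\<close> separates \<open>X\<close> from \<open>S\<close>, and every bramble set meets both.\<close>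
    have "covers Z \<B>"
      unfolding covers_def
    proof (intro ballI notI)
      fix U assume U: "U \<in> \<B>" "Z \<inter> U = {}"
      have conn: "cut_connected E U" "U \<subseteq> V" using B U unfolding bramble_def by blast+
      have "U \<subseteq> W \<union> C"
      proof (rule cut_connected_closed[OF conn(1)])
        show "(W \<union> C) \<inter> U \<noteq> {}" using X(2) U unfolding covers_def Z_def by blast
        fix a b assume ab: "a \<in> W \<union> C" "a \<in> U" "b \<in> U" "E a b"
        show "b \<in> W \<union> C"
        proof (cases "a \<in> C")
          case True
          then have "b \<in> C \<or> b \<in> X" using ab conn C(2) unfolding neighbours_def by blast
          then show ?thesis using U(2) ab(3) unfolding Z_def by blast
        next
          case False
          then have "a \<in> W - B" using ab U(2) unfolding Z_def by blast
          then show ?thesis using sep ab conn(2) by blast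
        qed
      qed
      moreover obtain s where "s \<in> S" "s \<in> U" using S(1) U(1) unfolding covers_def by blast
      ultimately show False using S(2) BW(5) U(2) unfolding Z_def by blast
    qed
    moreover have "Z \<subseteq> V" using BW(3,4) X(1) unfolding Z_def by blast
    ultimately have "card X \<le> card Z" using X_min by blast
    also have "\<dots> \<le> card (B - C) + card (X - W)" unfolding Z_def by (rule card_Un_le)
    also have "card X = card (X \<inter> W) + card (X - W)"
      using finite by (metis card_Int_Diff)
    finally have "card (X \<inter> W) \<le> card (B - C)" by simp
    moreover have "card T \<le> card (B \<inter> C) + card (X \<inter> W)" unfolding BW(2) by (rule card_Un_le)
    moreover have "card B = card (B \<inter> C) + card (B - C)" using finite by (metis card_Int_Diff)
    ultimately have "k < card B" using T(2) by simp
    \<comment> \<open>Without a vertex in \<open>C\<close> the new bag would lie in \<open>X\<close>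
      and be small. Hence the set of \<open>insert C \<B>\<close> that \<open>B\<close> misses is
      not \<open>C\<close> itself.\<close>
    moreover have "B \<inter> C \<noteq> {}"
    proof
      assume "B \<inter> C = {}"
      then have "card T \<le> card X" unfolding BW(2) using finite by (simp add: card_mono)
      then show False using X(3) T(2) by simp
    qed
    ultimately obtain U where U: "U \<in> \<B>" "B \<inter> U = {}"
      using F(2) BW(1) unfolding covers_def by blast
    have conn: "cut_connected E U" "U \<subseteq> V" using B U unfolding bramble_def by blast+
    \<comment> \<open>\<open>U\<close> avoids \<open>B\<close>, which separates the rest of
      \<open>W\<close> from the outside, so meeting \<open>W\<close> it would lie in
      \<open>W\<close> altogether; its vertex in \<open>S\<close> would then be in
      \<open>B\<close>.\<close>
    have "T \<inter> U = {}"
    proof (rule ccontr)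
      assume "T \<inter> U \<noteq> {}"
      then have "W \<inter> U \<noteq> {}" using U(2) BW(2) by blast
      then have "U \<subseteq> W"
        by (rule cut_connected_closed[OF conn(1)]) (use sep U(2) conn(2) in blast)
      moreover obtain s where "s \<in> S" "s \<in> U" using S(1) U(1) unfolding covers_def by blast
      ultimately show False using BW(5) U(2) by blast
    qed
    then show ?thesis using U(1) unfolding covers_def by blast
  qed
  then show ?thesis using F'(1) by blast
qed

text \<open>Induction from large brambles to small ones: a component of \<open>V - X\<close> that
  touches every bramble set can be added to the bramble. The conclusion tolerates large bags as long
  as they fail to cover; for the empty bramble, which everything covers, it bounds all bags.\<close>

lemma bramble_decomp:
  assumes fin: "finite V" and sym: "\<And>a b. E a b \<Longrightarrow> E b a"
    and small: "\<And>\<B>. bramble E V \<B> \<Longrightarrow> \<exists>X \<subseteq> V. covers X \<B> \<and> card X \<le> k"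
    and "bramble E V \<B>"
  shows "\<exists>F X. decomp E F X V \<and> (\<forall>T \<in> F. k < card T \<longrightarrow> \<not> covers T \<B>)"
  using assms(4)
proof (induction "card (Pow V - \<B>)" arbitrary: \<B> rule: less_induct)
  case less
  note B = less.prems
  obtain X where X: "X \<subseteq> V" "covers X \<B>" and X_min: "\<And>Z. Z \<subseteq> V \<Longrightarrow> covers Z \<B> \<Longrightarrow> card X \<le> card Z"
    using ex_has_least_nat[of "\<lambda>X. X \<subseteq> V \<and> covers X \<B>" _ card] small[OF B] by metis
  have kX: "card X \<le> k" using small[OF B] X_min le_trans by blast
  show ?case
  proof (rule ccontr)
    assume no: "\<nexists>F X. decomp E F X V \<and> (\<forall>T \<in> F. k < card T \<longrightarrow> \<not> covers T \<B>)"
    have "\<exists>F. decomp E F X (X \<union> C) \<and> (\<forall>T \<in> F. k < card T \<longrightarrow> \<not> covers T \<B>)"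
      if "C \<in> components E (V - X)" for C
    proof -
      note comp = component_subset[OF sym that] component_nonempty[OF sym that]
        component_connected[OF sym that] neighbours_component[OF sym that]
      have CX: "C \<inter> X = {}" "C \<subseteq> V" using comp by blast+
      show ?thesis
      proof (cases "\<forall>U \<in> \<B>. touching E C U")
        case False
        then obtain U where U: "U \<in> \<B>" "\<not> touching E C U" by blast
        \<comment> \<open>A component that does not touch \<open>U\<close> gets a single bag. This
          bag misses \<open>U\<close>, so its size does not matter.\<close>
        let ?Y = "C \<union> (neighbours E C \<inter> X)"
        have "decomp E ({X} \<union> {?Y}) X (X \<union> ?Y)"
        proof (rule decomp.attach[OF decomp.leaf decomp.leaf])
          show "\<not> E a b" if "a \<in> X - ?Y" "b \<in> ?Y - X" for a b
            using that CX sym unfolding neighbours_def by blast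
        qed (use CX in blast)+
        moreover have "X \<union> ?Y = X \<union> C" by blast
        moreover have "?Y \<inter> U = {}"
          using U(2) unfolding touching_def neighbours_def by blast
        then have "\<not> covers ?Y \<B>" using U(1) unfolding covers_def by blast
        ultimately show ?thesis using kX by (intro exI[of _ "{X} \<union> {?Y}"]) auto
      next
        case True
        have B': "bramble E V (insert C \<B>)"
        proof -
          have "touching E U C" if "U \<in> \<B>" for U
            by (rule touching_sym[OF bspec[OF True that] sym])
          moreover have "touching E C C" using comp(2) unfolding touching_def by blast
          ultimately have "\<forall>U \<in> insert C \<B>. \<forall>U' \<in> insert C \<B>. touching E U U'"
            using B True unfolding bramble_def by simp
          moreover have "insert C \<B> \<subseteq> Pow V" "\<forall>U \<in> insert C \<B>. U \<noteq> {} \<and> cut_connected E U"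
            using B comp(2,3) CX(2) unfolding bramble_def by simp_all
          ultimately show ?thesis unfolding bramble_def by simp
        qed
        have "C \<notin> \<B>" using X(2) CX(1) unfolding covers_def by (metis Int_commute)
        then have "Pow V - insert C \<B> \<subset> Pow V - \<B>" using CX by blast
        then have "card (Pow V - insert C \<B>) < card (Pow V - \<B>)"
          using fin by (simp add: psubset_card_mono)
        then obtain F R where F: "decomp E F R V" "\<forall>T \<in> F. k < card T \<longrightarrow> \<not> covers T (insert C \<B>)"
          using less.hyps B' by blast
        \<comment> \<open>The negated goal provides the bag to root at: \<open>F\<close> has a large
          bag covering \<open>\<B>\<close>, and since this bag does not cover
          \<open>insert C \<B>\<close>, it avoids \<open>C\<close>.\<close>
        then obtain S where S: "S \<in> F" "k < card S" "covers S \<B>" using no by blast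
        then have SC: "S \<inter> C = {}" using F(2) unfolding covers_def by (metis insert_iff)
        have NC: "neighbours E C \<inter> V \<subseteq> X" using comp(4) by blast
        show ?thesis
          by (rule bramble_decomp_step[OF fin sym B X kX X_min comp(1) NC
                decomp_reroot[OF F(1) S(1) sym] F(2) S(3) SC])
      qed
    qed
    then obtain F where F: "\<And>C. C \<in> components E (V - X) \<Longrightarrow> decomp E (F C) X (X \<union> C)"
      "\<And>C T. C \<in> components E (V - X) \<Longrightarrow> T \<in> F C \<Longrightarrow> k < card T \<Longrightarrow> \<not> covers T \<B>"
      by metis
    have "decomp E ({X} \<union> \<Union> (F ` components E (V - X))) X (X \<union> \<Union> (components E (V - X)))"
    proof (rule decomp_attach_family[OF _ decomp.leaf F(1)])
      show "finite (components E (V - X))" using fin finite_components by blast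
      show "\<not> E a b \<and> a \<noteq> b" if "C \<in> components E (V - X)" "D \<in> components E (V - X)" "C \<noteq> D"
        "a \<in> C" "b \<in> D" for C D a b
      proof -
        have "b \<notin> C" "a \<notin> D" using components_disjoint[OF sym that(1-3)] that by blast+
        then show ?thesis
          using neighbours_component[OF sym that(1)] component_subset[OF sym that(2)] that(4,5)
          unfolding neighbours_def by blast
      qed
    qed
    moreover have "X \<union> \<Union> (components E (V - X)) = V"
      using Union_components[of E "V - X"] sym X(1) by auto
    ultimately show False using no F(2) kX by auto
  qed
qed

theorem treewidth_duality:
  assumes "finite V" "\<And>a b. E a b \<Longrightarrow> E b a"
    and "\<And>\<B>. bramble E V \<B> \<Longrightarrow> \<exists>X \<subseteq> V. covers X \<B> \<and> card X \<le> k"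
  shows "\<exists>F X. decomp E F X V \<and> (\<forall>T \<in> F. card T \<le> k)"
proof -
  have "bramble E V {}" unfolding bramble_def by simp
  from bramble_decomp[OF assms this] show ?thesis unfolding covers_def by (meson ball_empty not_less)
qed

subsection \<open>Stratified decompositions and torsos\<close>

text \<open>Complete subtrees are attached to the root only, so \<open>W' - X\<close> is what a new
  child brings strictly below the bag \<open>X\<close>. The last premise is thus the stratification
  condition for cops on a bag and a robber below it. It depends on the root, so the right root must
  be chosen before passing from \<open>decomp\<close> to this form.\<close>

inductive strat_decomp ::
    "('a \<Rightarrow> 'a \<Rightarrow> bool) \<Rightarrow> ('a \<Rightarrow> nat) \<Rightarrow> nat \<Rightarrow> 'a set \<Rightarrow> 'a set \<Rightarrow> bool"
  for E :: "'a \<Rightarrow> 'a \<Rightarrow> bool" and d :: "'a \<Rightarrow> nat" and k :: nat where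
  leaf: "card X \<le> k \<Longrightarrow> strat_decomp E d k X X"
| attach: "\<lbrakk>strat_decomp E d k X W; strat_decomp E d k Y W'; W \<inter> W' \<subseteq> X; W \<inter> W' \<subseteq> Y;
    \<And>a b. a \<in> W - W' \<Longrightarrow> b \<in> W' - W \<Longrightarrow> \<not> E a b;
    \<And>x r. x \<in> X \<Longrightarrow> r \<in> W' - X \<Longrightarrow> d x \<le> d r\<rbrakk> \<Longrightarrow> strat_decomp E d k X (W \<union> W')"

lemma strat_decomp_attach_family:
  assumes "finite \<D>" "card X \<le> k" and sym: "\<And>a b. E a b \<Longrightarrow> E b a"
    and D: "\<And>D. D \<in> \<D> \<Longrightarrow> \<exists>R. strat_decomp E d k R (D \<union> neighbours E D) \<and> neighbours E D \<subseteq> R"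
    and nb: "\<And>D. D \<in> \<D> \<Longrightarrow> neighbours E D \<subseteq> X"
    and disj: "\<And>D. D \<in> \<D> \<Longrightarrow> D \<inter> X = {}"
      "\<And>D D'. D \<in> \<D> \<Longrightarrow> D' \<in> \<D> \<Longrightarrow> D \<noteq> D' \<Longrightarrow> D \<inter> D' = {}"
    and d: "\<And>D x r. D \<in> \<D> \<Longrightarrow> x \<in> X \<Longrightarrow> r \<in> D \<Longrightarrow> d x \<le> d r"
  shows "strat_decomp E d k X (X \<union> \<Union>\<D>)"
proof -
  have "strat_decomp E d k X (X \<union> \<Union>\<D>')" if "\<D>' \<subseteq> \<D>" for \<D>'
    using finite_subset[OF that assms(1)] that
  proof (induction rule: finite_induct)
    case empty
    then show ?case using strat_decomp.leaf[OF assms(2)] by simp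
  next
    case (insert D \<D>')
    then have DD: "D \<in> \<D>" "\<D>' \<subseteq> \<D>" by blast+
    obtain R where R: "strat_decomp E d k R (D \<union> neighbours E D)" "neighbours E D \<subseteq> R"
      using assms(4)[OF DD(1)] by blast
    have "D \<inter> D' = {}" if "D' \<in> \<D>'" for D'
      using disj(2)[of D D'] that DD insert.hyps by blast
    then have disj': "D \<inter> (X \<union> \<Union>\<D>') = {}" using disj(1)[OF DD(1)] by blast
    have "strat_decomp E d k X ((X \<union> \<Union>\<D>') \<union> (D \<union> neighbours E D))"
    proof (rule strat_decomp.attach[OF insert.IH[OF DD(2)] R(1)])
      show "(X \<union> \<Union>\<D>') \<inter> (D \<union> neighbours E D) \<subseteq> X" using disj' nb[OF DD(1)] by blast
      show "(X \<union> \<Union>\<D>') \<inter> (D \<union> neighbours E D) \<subseteq> R" using disj' R(2) by blast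
      show "\<not> E a b" if "a \<in> X \<union> \<Union>\<D>' - (D \<union> neighbours E D)"
        "b \<in> D \<union> neighbours E D - (X \<union> \<Union>\<D>')" for a b
        using that nb[OF DD(1)] sym[of a b] unfolding neighbours_def by blast
      show "d x \<le> d r" if "x \<in> X" "r \<in> D \<union> neighbours E D - X" for x r
        using that nb[OF DD(1)] d[OF DD(1)] by blast
    qed
    moreover have "(X \<union> \<Union>\<D>') \<union> (D \<union> neighbours E D) = X \<union> \<Union> (insert D \<D>')"
      using nb[OF DD(1)] by blast
    ultimately show ?case by simp
  qed
  then show ?thesis by blast
qed

definition upper_part :: "('a \<Rightarrow> 'a \<Rightarrow> bool) \<Rightarrow> ('a \<Rightarrow> nat) \<Rightarrow> 'a set \<Rightarrow> bool" where
  "upper_part E d C \<longleftrightarrow> C \<noteq> {} \<and> cut_connected E C \<and> (\<forall>u \<in> C. \<forall>v \<in> neighbours E C. d v < d u)"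

definition bottom :: "('a \<Rightarrow> nat) \<Rightarrow> 'a set \<Rightarrow> nat" where
  "bottom d C = Min (d ` C)"

definition above_bottom :: "('a \<Rightarrow> nat) \<Rightarrow> 'a set \<Rightarrow> 'a set" where
  "above_bottom d C = {v \<in> C. bottom d C < d v}"

definition torso_verts :: "('a \<Rightarrow> 'a \<Rightarrow> bool) \<Rightarrow> ('a \<Rightarrow> nat) \<Rightarrow> 'a set \<Rightarrow> 'a set" where
  "torso_verts E d C = {v \<in> C. d v = bottom d C} \<union> neighbours E C"

text \<open>Neither confined to \<open>torso_verts\<close> nor irreflexive: decompositions and
  brambles compare only vertices of their own ground set, and a loop adds neither a connection nor a
  touching pair.\<close>

definition torso :: "('a \<Rightarrow> 'a \<Rightarrow> bool) \<Rightarrow> ('a \<Rightarrow> nat) \<Rightarrow> 'a set \<Rightarrow> 'a \<Rightarrow> 'a \<Rightarrow> bool" where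
  "torso E d C a b \<longleftrightarrow> E a b \<or> a \<in> neighbours E C \<and> b \<in> neighbours E C \<or>
     (\<exists>D \<in> components E (above_bottom d C). a \<in> neighbours E D \<and> b \<in> neighbours E D)"

lemma torso_sym: "(\<And>a b. E a b \<Longrightarrow> E b a) \<Longrightarrow> torso E d C a b \<Longrightarrow> torso E d C b a"
  unfolding torso_def by metis

lemma bottom_le: "finite C \<Longrightarrow> v \<in> C \<Longrightarrow> bottom d C \<le> d v"
  unfolding bottom_def by simp

lemma bottom_attained:
  assumes "finite C" "C \<noteq> {}"
  shows "\<exists>v \<in> C. d v = bottom d C"
proof -
  have "bottom d C \<in> d ` C" unfolding bottom_def by (rule Min_in) (use assms in auto)
  then show ?thesis by (auto simp: image_iff)
qed

lemma torso_verts_le_bottom: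
  assumes "finite C" "upper_part E d C" "v \<in> torso_verts E d C"
  shows "d v \<le> bottom d C"
proof -
  obtain u where u: "u \<in> C" "d u = bottom d C"
    using bottom_attained[OF assms(1)] assms(2) unfolding upper_part_def by blast
  have "d v < d u" if "v \<in> neighbours E C" using assms(2) u(1) that unfolding upper_part_def by blast
  then show ?thesis using assms(3) u(2) unfolding torso_verts_def by auto
qed

lemma neighbours_lt_bottom:
  assumes "finite C" "upper_part E d C" "v \<in> neighbours E C"
  shows "d v < bottom d C"
proof -
  obtain u where "u \<in> C" "d u = bottom d C"
    using bottom_attained[OF assms(1)] assms(2) unfolding upper_part_def by blast
  then show ?thesis using assms(2,3) unfolding upper_part_def by metis
qed

text \<open>By maximality of \<open>D\<close>, a neighbour of \<open>D\<close> in \<open>C\<close>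
  is on the bottom level; one outside \<open>C\<close> is lower still. Either way it lies strictly
  below \<open>D\<close>. Properness, which drives the recursion, holds because the bottom level is
  inhabited.\<close>

lemma upper_part_above_bottom:
  assumes sym: "\<And>a b. E a b \<Longrightarrow> E b a" and fin: "finite C"
    and C: "upper_part E d C" and D: "D \<in> components E (above_bottom d C)"
  shows "upper_part E d D" "D \<subset> C" "neighbours E D \<subseteq> torso_verts E d C"
proof -
  note comp = component_subset[OF sym D] component_nonempty[OF sym D]
    component_connected[OF sym D] neighbours_component[OF sym D]
  have DC: "D \<subseteq> C" and high: "\<And>v. v \<in> D \<Longrightarrow> bottom d C < d v"
    using comp(1) unfolding above_bottom_def by blast+
  show nb: "neighbours E D \<subseteq> torso_verts E d C"
  proof
    fix v assume v: "v \<in> neighbours E D"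
    then have "v \<notin> above_bottom d C" using comp(4) by blast
    moreover have "bottom d C \<le> d v" if "v \<in> C" using bottom_le[OF fin that] .
    moreover have "v \<in> C \<or> v \<in> neighbours E C" using v DC unfolding neighbours_def by blast
    ultimately show "v \<in> torso_verts E d C" unfolding above_bottom_def torso_verts_def by force
  qed
  show "upper_part E d D"
    unfolding upper_part_def
  proof (intro conjI ballI)
    fix u v assume uv: "u \<in> D" "v \<in> neighbours E D"
    have "d v \<le> bottom d C" using torso_verts_le_bottom[OF fin C] nb uv(2) by blast
    then show "d v < d u" using high[OF uv(1)] by linarith
  qed (use comp in blast)+
  obtain u where "u \<in> C" "d u = bottom d C"
    using bottom_attained[OF fin] C unfolding upper_part_def by blast
  then have "u \<in> C - D" using high by fastforce
  then show "D \<subset> C" using DC by blast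
qed

text \<open>Each component above the bottom level is hung at a bag containing its neighbours. As the
  root bag holds all neighbours of \<open>C\<close> in \<open>W\<close>, only bottom-level vertices
  and such components lie below it, while no bag vertex of the torso exceeds the bottom level. The
  family \<open>\<D>\<close> is kept general because the induction distributes it over the two
  halves.\<close>

lemma strat_decomp_of_torso:
  assumes "decomp (torso E d C) F X W" "W \<subseteq> torso_verts E d C" "neighbours E C \<inter> W \<subseteq> X"
    "\<forall>S \<in> F. card S \<le> k" "\<D> \<subseteq> components E (above_bottom d C)" "\<forall>D \<in> \<D>. \<exists>Z \<in> F. neighbours E D \<subseteq> Z"
    and sym: "\<And>a b. E a b \<Longrightarrow> E b a" and fin: "finite C" and C: "upper_part E d C"
    and IH: "\<And>D. D \<in> components E (above_bottom d C) \<Longrightarrow>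
      \<exists>R. strat_decomp E d k R (D \<union> neighbours E D) \<and> neighbours E D \<subseteq> R"
  shows "strat_decomp E d k X (W \<union> \<Union>\<D>)"
  using assms(1-6)
proof (induction arbitrary: \<D> rule: decomp.induct)
  case (leaf X)
  have le: "d x \<le> bottom d C" if "x \<in> X" for x
    using torso_verts_le_bottom[OF fin C] that leaf.prems by blast
  have high: "D \<subseteq> above_bottom d C" if "D \<in> \<D>" for D
    by (rule component_subset[OF sym subsetD[OF leaf.prems(4) that]])
  have finite: "finite (above_bottom d C)" using fin unfolding above_bottom_def by simp
  show ?case
  proof (rule strat_decomp_attach_family)
    show "finite \<D>" using finite_subset[OF leaf.prems(4) finite_components[OF finite]] .
    show "\<exists>R. strat_decomp E d k R (D \<union> neighbours E D) \<and> neighbours E D \<subseteq> R" if "D \<in> \<D>" for D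
      using IH leaf.prems(4) that by blast
    show "D \<inter> X = {}" if "D \<in> \<D>" for D
      using high[OF that] le unfolding above_bottom_def by force
    show "D \<inter> D' = {}" if "D \<in> \<D>" "D' \<in> \<D>" "D \<noteq> D'" for D D'
      using components_disjoint[of E D "above_bottom d C" D'] sym leaf.prems(4) that by blast
    show "d x \<le> d r" if "D \<in> \<D>" "x \<in> X" "r \<in> D" for D x r
      using high[OF that(1)] le[OF that(2)] that(3) unfolding above_bottom_def by force
  qed (use leaf.prems sym in auto)
next
  case (attach F1 X W1 F2 Y W2)
  \<comment> \<open>A component whose neighbours fit into bags of both halves must be hung only
    once; the first half takes it.\<close>
  define \<D>1 where "\<D>1 = {D \<in> \<D>. \<exists>Z \<in> F1. neighbours E D \<subseteq> Z}"
  define \<D>2 where "\<D>2 = \<D> - \<D>1"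
  have split: "\<D> = \<D>1 \<union> \<D>2" "\<D>1 \<inter> \<D>2 = {}" unfolding \<D>1_def \<D>2_def by blast+
  have in2: "\<forall>D \<in> \<D>2. \<exists>Z \<in> F2. neighbours E D \<subseteq> Z"
    using attach.prems(5) unfolding \<D>1_def \<D>2_def by blast
  have XW: "X \<subseteq> W1" using attach.hyps(1) decomp_root decomp_bag_subset by metis
  have nb1: "neighbours E D \<subseteq> W1" if "D \<in> \<D>1" for D
    using that decomp_bag_subset[OF attach.hyps(1)] unfolding \<D>1_def by blast
  have nb2: "neighbours E D \<subseteq> W2" if "D \<in> \<D>2" for D
    using that in2 decomp_bag_subset[OF attach.hyps(2)] by blast
  have high: "D \<subseteq> above_bottom d C" if "D \<in> \<D>" for D
    by (rule component_subset[OF sym subsetD[OF attach.prems(4) that]])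
  have le: "d x \<le> bottom d C" if "x \<in> W1 \<union> W2" for x
    using torso_verts_le_bottom[OF fin C] that attach.prems(1) by blast
  have out: "D \<inter> (W1 \<union> W2) = {}" if "D \<in> \<D>" for D
    using high[OF that] le unfolding above_bottom_def by force
  have disj: "D \<inter> D' = {}" if "D \<in> \<D>1" "D' \<in> \<D>2" for D D'
    using components_disjoint[of E D "above_bottom d C" D'] sym attach.prems(4) that split by blast
  have U: "\<Union>\<D>1 \<inter> (W1 \<union> W2) = {}" "\<Union>\<D>2 \<inter> (W1 \<union> W2) = {}" "\<Union>\<D>1 \<inter> \<Union>\<D>2 = {}"
    using out disj split(1) by blast+
  have nbU: "b \<in> W1 \<union> \<Union>\<D>1" if "a \<in> \<Union>\<D>1" "E a b" for a b
    using that nb1 unfolding neighbours_def by blast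
  have nbU2: "b \<in> W2 \<union> \<Union>\<D>2" if "a \<in> \<Union>\<D>2" "E a b" for a b
    using that nb2 unfolding neighbours_def by blast
  have s1: "strat_decomp E d k X (W1 \<union> \<Union>\<D>1)"
  proof (rule attach.IH(1))
    show "neighbours E C \<inter> W1 \<subseteq> X" using attach.prems(2) by blast
    show "\<D>1 \<subseteq> components E (above_bottom d C)" using attach.prems(4) split(1) by blast
    show "\<forall>D \<in> \<D>1. \<exists>Z \<in> F1. neighbours E D \<subseteq> Z" unfolding \<D>1_def by blast
  qed (use attach.prems(1,3) in simp_all)
  have s2: "strat_decomp E d k Y (W2 \<union> \<Union>\<D>2)"
  proof (rule attach.IH(2))
    \<comment> \<open>Neighbours of \<open>C\<close> in the second half are in \<open>X\<close>,
      hence in the overlap \<open>W1 \<inter> W2\<close>, hence in \<open>Y\<close>.\<close>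
    show "neighbours E C \<inter> W2 \<subseteq> Y" using attach.prems(2) XW attach.hyps(4) by blast
    show "\<D>2 \<subseteq> components E (above_bottom d C)" using attach.prems(4) split(1) by blast
  qed (use attach.prems(1,3) in2 in simp_all)
  have "strat_decomp E d k X ((W1 \<union> \<Union>\<D>1) \<union> (W2 \<union> \<Union>\<D>2))"
  proof (rule strat_decomp.attach[OF s1 s2])
    show "(W1 \<union> \<Union>\<D>1) \<inter> (W2 \<union> \<Union>\<D>2) \<subseteq> X" "(W1 \<union> \<Union>\<D>1) \<inter> (W2 \<union> \<Union>\<D>2) \<subseteq> Y"
      using U attach.hyps(3,4) by blast+
    show "\<not> E a b" if ab: "a \<in> W1 \<union> \<Union>\<D>1 - (W2 \<union> \<Union>\<D>2)" "b \<in> W2 \<union> \<Union>\<D>2 - (W1 \<union> \<Union>\<D>1)" for a b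
    proof
      assume e: "E a b"
      have "a \<notin> \<Union>\<D>1" "b \<notin> \<Union>\<D>2" using nbU[of a b] nbU2[of b a] e sym[of a b] ab by blast+
      then have "\<not> torso E d C a b" using attach.hyps(5)[of a b] ab by blast
      then show False using e unfolding torso_def by blast
    qed
    show "d x \<le> d r" if xr: "x \<in> X" "r \<in> W2 \<union> \<Union>\<D>2 - X" for x r
    proof -
      have x: "d x \<le> bottom d C" using le xr XW by blast
      consider "r \<in> W2" "r \<notin> neighbours E C" | D where "D \<in> \<D>" "r \<in> D"
        using xr attach.prems(2) split(1) by blast
      then show ?thesis
      proof cases
        case 1
        then have "d r = bottom d C" using attach.prems(1) unfolding torso_verts_def by blast
        then show ?thesis using x by simp
      next
        case 2
        then show ?thesis using x high unfolding above_bottom_def by force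
      qed
    qed
  qed
  moreover have "(W1 \<union> \<Union>\<D>1) \<union> (W2 \<union> \<Union>\<D>2) = W1 \<union> W2 \<union> \<Union>\<D>" using split(1) by blast
  ultimately show ?case by simp
qed

text \<open>Induction on \<open>C\<close>, with the tree rooted at a bag that contains the clique on
  the neighbours of \<open>C\<close>. Having these neighbours in the root bag is what allows the
  result to hang inside the tree of a larger upper part.\<close>

lemma strat_decomp_upper_part:
  assumes sym: "\<And>a b. E a b \<Longrightarrow> E b a"
    and torsos: "\<And>C. C \<subseteq> V \<Longrightarrow> upper_part E d C \<Longrightarrow>
      \<exists>F X. decomp (torso E d C) F X (torso_verts E d C) \<and> (\<forall>S \<in> F. card S \<le> k)"
    and "finite V" "C \<subseteq> V" "upper_part E d C"
  shows "\<exists>R. strat_decomp E d k R (C \<union> neighbours E C) \<and> neighbours E C \<subseteq> R"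
  using finite_subset[OF assms(4,3)] assms(4,5)
proof (induction rule: finite_psubset_induct)
  case (psubset C)
  note fin = psubset.hyps and C = psubset.prems(2)
  note tsym = torso_sym[of E, OF sym]
  obtain F X where F: "decomp (torso E d C) F X (torso_verts E d C)" "\<forall>S \<in> F. card S \<le> k"
    using torsos psubset.prems by blast
  have "\<exists>Z \<in> F. neighbours E C \<subseteq> Z"
    by (rule decomp_clique_in_bag[OF F(1)]) (auto simp: torso_def torso_verts_def)
  then obtain Z where Z: "Z \<in> F" "neighbours E C \<subseteq> Z" by blast
  let ?\<D> = "components E (above_bottom d C)"
  have "strat_decomp E d k Z (torso_verts E d C \<union> \<Union>?\<D>)"
  proof (rule strat_decomp_of_torso[OF decomp_reroot[OF F(1) Z(1) tsym] order_refl _ F(2) order_refl _ sym fin C])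
    show "neighbours E C \<inter> torso_verts E d C \<subseteq> Z" using Z(2) by blast
    show "\<forall>D \<in> ?\<D>. \<exists>Z \<in> F. neighbours E D \<subseteq> Z"
    proof
      fix D assume D: "D \<in> ?\<D>"
      show "\<exists>Z \<in> F. neighbours E D \<subseteq> Z"
      proof (rule decomp_clique_in_bag[OF F(1)])
        show "neighbours E D \<subseteq> torso_verts E d C" by (rule upper_part_above_bottom(3)[OF sym fin C D])
        show "torso E d C a b" if "a \<in> neighbours E D" "b \<in> neighbours E D" for a b
          unfolding torso_def using that D by blast
      qed
    qed
    show "\<exists>R. strat_decomp E d k R (D \<union> neighbours E D) \<and> neighbours E D \<subseteq> R" if D: "D \<in> ?\<D>" for D
      using psubset.IH[of D] upper_part_above_bottom[OF sym fin C D] psubset.prems(1) by blast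
  qed
  moreover have "torso_verts E d C \<union> \<Union>?\<D> = C \<union> neighbours E C"
  proof -
    have "\<Union>?\<D> = above_bottom d C" using Union_components[of E "above_bottom d C"] sym by blast
    moreover have "d v = bottom d C \<or> bottom d C < d v" if "v \<in> C" for v
      using bottom_le[OF fin that, of d] by linarith
    ultimately show ?thesis unfolding torso_verts_def above_bottom_def by blast
  qed
  ultimately show ?case using Z(2) by auto
qed

theorem strat_decomp_from_torsos:
  assumes sym: "\<And>a b. E a b \<Longrightarrow> E b a" and fin: "finite V" and E: "\<And>a b. E a b \<Longrightarrow> a \<in> V \<and> b \<in> V"
    and torsos: "\<And>C. C \<subseteq> V \<Longrightarrow> upper_part E d C \<Longrightarrow>
      \<exists>F X. decomp (torso E d C) F X (torso_verts E d C) \<and> (\<forall>S \<in> F. card S \<le> k)"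
  shows "strat_decomp E d k {} V"
proof -
  have nb: "neighbours E C = {}" if C: "C \<in> components E V" for C
    using neighbours_component[OF sym C] E unfolding neighbours_def by blast
  \<comment> \<open>Components of the whole graph have no neighbours and so are upper parts
    vacuously. An empty root bag ties them together, even if there are none.\<close>
  have "strat_decomp E d k {} ({} \<union> \<Union> (components E V))"
  proof (rule strat_decomp_attach_family)
    show "finite (components E V)" by (rule finite_components[OF fin])
    show "\<exists>R. strat_decomp E d k R (C \<union> neighbours E C) \<and> neighbours E C \<subseteq> R"
      if C: "C \<in> components E V" for C
    proof (rule strat_decomp_upper_part[OF sym torsos fin])
      show "upper_part E d C" unfolding upper_part_def
        using component_nonempty[OF sym C] component_connected[OF sym C] nb[OF C] by blast
    qed (use component_subset[OF sym C] in blast)+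
    show "C \<inter> D = {}" if "C \<in> components E V" "D \<in> components E V" "C \<noteq> D" for C D
      using components_disjoint[OF sym that] .
  qed (use nb sym in auto)
  then show ?thesis using Union_components[of E V] sym by simp
qed

subsection \<open>Playing the game\<close>

abbreviation adj :: "'a pair_pre_digraph \<Rightarrow> 'a \<Rightarrow> 'a \<Rightarrow> bool" where
  "adj G \<equiv> \<lambda>a b. (a, b) \<in> parcs G"

lemma
  assumes "pair_graph G"
  shows pair_graph_sym: "(a, b) \<in> parcs G \<Longrightarrow> (b, a) \<in> parcs G"
    and pair_graph_verts: "(a, b) \<in> parcs G \<Longrightarrow> a \<in> pverts G \<and> b \<in> pverts G"
    and pair_graph_finite: "finite (pverts G)"
proof -
  interpret pair_graph G by (rule assms)
  show "(a, b) \<in> parcs G \<Longrightarrow> (b, a) \<in> parcs G" by (rule arcs_symmetric)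
  show "(a, b) \<in> parcs G \<Longrightarrow> a \<in> pverts G \<and> b \<in> pverts G" using in_arcsD1 in_arcsD2 by blast
  show "finite (pverts G)" by (rule pair_finite_verts)
qed

lemma component_without_rtrancl_on:
  "component_without G X r = {v. (r, v) \<in> rtrancl_on (pverts G - X)
     {(a, b) \<in> parcs G. a \<notin> X \<and> b \<notin> X \<and> a \<in> pverts G \<and> b \<in> pverts G}}"
proof -
  have "arcs_ends (with_proj G \<restriction> (pverts G - X)) =
    {(a, b) \<in> parcs G. a \<notin> X \<and> b \<notin> X \<and> a \<in> pverts G \<and> b \<in> pverts G}"
    unfolding arcs_ends_def arc_to_ends_def induce_subgraph_def by auto
  then show ?thesis
    unfolding component_without_def reachable_def by (simp add: induce_subgraph_def)
qed

lemma component_without_subset: "component_without G X r \<subseteq> pverts G - X"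
  unfolding component_without_rtrancl_on by (auto dest: in_rtrancl_on_in_F)

lemma component_without_self: "r \<in> pverts G - X \<Longrightarrow> r \<in> component_without G X r"
  unfolding component_without_rtrancl_on by blast

lemma component_without_start: "v \<in> component_without G X r \<Longrightarrow> r \<in> pverts G - X"
  unfolding component_without_rtrancl_on by (auto dest: in_rtrancl_on_in_F)

lemma component_without_step:
  assumes "a \<in> component_without G X r" "(a, b) \<in> parcs G" "b \<in> pverts G - X"
  shows "b \<in> component_without G X r"
proof -
  have "a \<in> pverts G - X" using assms(1) component_without_subset[of G X r] by blast
  then have ab: "(a, b) \<in> {(a, b) \<in> parcs G. a \<notin> X \<and> b \<notin> X \<and> a \<in> pverts G \<and> b \<in> pverts G}"
    using assms(2,3) by blast
  show ?thesis
    using assms(1) rtrancl_on_into_rtrancl_on[OF _ ab assms(3)]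
    unfolding component_without_rtrancl_on by simp
qed

lemma component_without_induct [consumes 1, case_names base step]:
  assumes "v \<in> component_without G X r" "P r"
    and "\<And>a b. a \<in> component_without G X r \<Longrightarrow> P a \<Longrightarrow> (a, b) \<in> parcs G \<Longrightarrow> b \<in> pverts G - X \<Longrightarrow> P b"
  shows "P v"
proof -
  have "(r, v) \<in> rtrancl_on (pverts G - X)
      {(a, b) \<in> parcs G. a \<notin> X \<and> b \<notin> X \<and> a \<in> pverts G \<and> b \<in> pverts G}"
    using assms(1) unfolding component_without_rtrancl_on by blast
  then show ?thesis
  proof (induction rule: rtrancl_on_induct)
    case (step y z)
    then show ?case using assms(3)[of y z] unfolding component_without_rtrancl_on by blast
  qed (rule assms(2))
qed

lemma cut_connected_in_component:
  assumes "cut_connected (adj G) U" "U \<subseteq> pverts G - X" "component_without G X r \<inter> U \<noteq> {}"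
  shows "U \<subseteq> component_without G X r"
  by (rule cut_connected_closed[OF assms(1,3)]) (use assms(2) component_without_step[of _ G X r] in blast)

text \<open>How a torso edge is walked in \<open>G\<close>: step from \<open>a\<close> into the
  connected set \<open>D\<close>, cross it, and step out to \<open>b\<close>.\<close>

lemma component_through:
  assumes D: "cut_connected (adj G) D" "D \<noteq> {}" "D \<subseteq> pverts G - X"
    and ab: "a \<in> neighbours (adj G) D" "b \<in> neighbours (adj G) D"
    and sym: "\<And>a b. (a, b) \<in> parcs G \<Longrightarrow> (b, a) \<in> parcs G"
    and mem: "a \<in> component_without G X r" "b \<in> pverts G - X"
  shows "b \<in> component_without G X r"
proof -
  obtain u where u: "u \<in> D" "(u, a) \<in> parcs G" using ab(1) unfolding neighbours_def by blast
  obtain w where w: "w \<in> D" "(w, b) \<in> parcs G" using ab(2) unfolding neighbours_def by blast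
  have "u \<in> component_without G X r"
    by (rule component_without_step[OF mem(1)]) (use u sym[of u a] D(3) in blast)+
  then have "D \<subseteq> component_without G X r"
    by (intro cut_connected_in_component[OF D(1,3)]) (use u in blast)
  then show ?thesis using component_without_step[of w G X r b] w mem(2) by blast
qed

section \<open>The robber's side: evasion inside a bramble of a torso\<close>

context
  fixes G :: "'a pair_pre_digraph" and d :: "'a \<Rightarrow> nat" and C :: "'a set" and \<B> :: "'a set set"
  assumes G: "pair_graph G" and C: "C \<subseteq> pverts G" "upper_part (adj G) d C"
    and B: "bramble (torso (adj G) d C) (torso_verts (adj G) d C) \<B>"
begin

lemmas adj_sym = pair_graph_sym[OF G] and adj_verts = pair_graph_verts[OF G]

lemma finite_C: "finite C"
  using C(1) pair_graph_finite[OF G] finite_subset by blast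

lemma torso_verts_subset: "torso_verts (adj G) d C \<subseteq> pverts G"
  using C(1) adj_verts unfolding torso_verts_def neighbours_def by blast

text \<open>The robber's own vertex belongs to her space and lies at most on the bottom level, which
  already forbids cops on higher levels.\<close>

lemma cops_avoid_above_bottom:
  assumes "stratified_position G d (X, r)" "r \<in> torso_verts (adj G) d C" "r \<notin> X"
    "D \<in> components (adj G) (above_bottom d C)"
  shows "D \<inter> X = {}"
proof (rule ccontr)
  assume "D \<inter> X \<noteq> {}"
  then obtain x where x: "x \<in> X" "bottom d C < d x"
    using component_subset[OF adj_sym assms(4)] unfolding above_bottom_def by blast
  have "r \<in> robber_space G (X, r)"
    using assms torso_verts_subset unfolding robber_space_def by (auto intro!: component_without_self)
  then have "d x \<le> d r" using assms(1) x(1) unfolding stratified_position_def by simp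
  then show False
    using torso_verts_le_bottom[OF finite_C C(2) assms(2)] x(2) by simp
qed

text \<open>
  A torso edge is realised by a path through \<open>C\<close> or through a component above the bottom level. The
  cops cannot block the latter, and they can only block the former if the robber, who may step to
  a neighbour of \<open>C\<close>, finds that stratification is violated there.
\<close>

lemma robber_reaches_bramble_set:
  assumes strat: "stratified_position G d (X, r)"
    and next_strat: "\<And>a. a \<in> component_without G (X \<inter> Y) r \<Longrightarrow> stratified_position G d (Y, a)"
    and U: "U \<in> \<B>" "r \<in> U" "U \<inter> X = {}" and U': "U' \<in> \<B>" "U' \<inter> Y = {}"
  shows "U' \<subseteq> component_without G (X \<inter> Y) r"
proof -
  let ?K = "component_without G (X \<inter> Y) r" and ?R = "component_without G X r"
  let ?T = "torso (adj G) d C"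
  have UV: "U \<subseteq> torso_verts (adj G) d C" "U' \<subseteq> torso_verts (adj G) d C"
    and conn: "cut_connected ?T U" "cut_connected ?T U'" and touch: "touching ?T U U'"
    using B U U' unfolding bramble_def by blast+
  have r: "r \<in> torso_verts (adj G) d C" "r \<notin> X" using U UV by blast+
  have rV: "r \<in> pverts G" using r torso_verts_subset by blast
  have Cc: "cut_connected (adj G) C" "C \<noteq> {}" using C(2) unfolding upper_part_def by blast+
  have high: "D \<inter> X = {}" "D \<subseteq> pverts G" "D \<noteq> {}" "cut_connected (adj G) D"
    if D: "D \<in> components (adj G) (above_bottom d C)" for D
    using cops_avoid_above_bottom[OF strat r D] component_nonempty[OF adj_sym D]
      component_connected[OF adj_sym D] component_subset[OF adj_sym D] C(1)
    unfolding above_bottom_def by blast+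
  \<comment> \<open>A cop on \<open>C\<close> is at least on the bottom level and a neighbour of
    \<open>C\<close> strictly below it, so stratification shuts such neighbours out of the robber's
    space.\<close>
  have no_nb: "a \<notin> ?R" if "x \<in> X \<inter> C" "a \<in> neighbours (adj G) C" for a x
  proof
    assume "a \<in> ?R"
    then have "d x \<le> d a" using strat that unfolding stratified_position_def robber_space_def by simp
    moreover have "d a < bottom d C" by (rule neighbours_lt_bottom[OF finite_C C(2) that(2)])
    moreover have "bottom d C \<le> d x" using bottom_le[OF finite_C] that(1) by blast
    ultimately show False by simp
  qed
  \<comment> \<open>With a cop on \<open>C\<close>, the clique edges between neighbours of
    \<open>C\<close> can never be entered, by \<open>no_nb\<close>, and all other torso edges can be
    walked. So \<open>U\<close> lies in the robber's space and contains no such neighbour.\<close>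
  have U_inner: "U \<inter> neighbours (adj G) C = {}" if x: "x \<in> X \<inter> C" for x
  proof -
    have "U \<subseteq> ?R"
    proof (rule cut_connected_closed[OF conn(1)])
      show "?R \<inter> U \<noteq> {}" using component_without_self[of r G X] rV r U(2) by blast
      fix a b assume ab: "a \<in> ?R" "a \<in> U" "b \<in> U" "?T a b"
      have b: "b \<in> pverts G - X" using ab U(3) UV torso_verts_subset by blast
      show "b \<in> ?R"
        using ab(4) unfolding torso_def
      proof (elim disjE bexE)
        fix D assume D: "D \<in> components (adj G) (above_bottom d C)"
          "a \<in> neighbours (adj G) D \<and> b \<in> neighbours (adj G) D"
        have "D \<subseteq> pverts G - X" using high(1,2)[OF D(1)] by blast
        then show "b \<in> ?R"
          using component_through[OF high(4,3)[OF D(1)] _ _ _ adj_sym ab(1) b] D(2) by blast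
      qed (use component_without_step[OF ab(1) _ b] no_nb[OF x, of a] ab(1) in blast)+
    qed
    then show ?thesis using no_nb[OF x] by blast
  qed
  have "U \<union> U' \<subseteq> ?K"
  proof (rule cut_connected_closed)
    show "cut_connected ?T (U \<union> U')"
      using cut_connected_Un[OF conn] torso_sym[of "adj G" d C, OF adj_sym] touch
      unfolding touching_def by blast
    show "?K \<inter> (U \<union> U') \<noteq> {}" using component_without_self[of r G "X \<inter> Y"] rV r U(2) by blast
    fix a b assume ab: "a \<in> ?K" "a \<in> U \<union> U'" "b \<in> U \<union> U'" "?T a b"
    have b: "b \<in> pverts G - X \<inter> Y" using ab U(3) U'(2) UV torso_verts_subset by blast
    show "b \<in> ?K"
      using ab(4) unfolding torso_def
    proof (elim disjE bexE)
      fix D assume D: "D \<in> components (adj G) (above_bottom d C)"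
        "a \<in> neighbours (adj G) D \<and> b \<in> neighbours (adj G) D"
      have "D \<subseteq> pverts G - X \<inter> Y" using high(1,2)[OF D(1)] by blast
      then show "b \<in> ?K"
        using component_through[OF high(4,3)[OF D(1)] _ _ _ adj_sym ab(1) b] D(2) by blast
    next
      \<comment> \<open>Only a cop staying on \<open>C\<close> during the move could block this
        detour. By \<open>U_inner\<close> it forces \<open>a\<close> into \<open>U'\<close>, which
        avoids \<open>Y\<close>; but the robber can reach \<open>a\<close>, and with her there the
        announced set would be illegal.\<close>
      assume nb: "a \<in> neighbours (adj G) C \<and> b \<in> neighbours (adj G) C"
      have "X \<inter> Y \<inter> C = {}"
      proof (rule ccontr)
        assume "X \<inter> Y \<inter> C \<noteq> {}"
        then obtain x where x: "x \<in> X \<inter> C" "x \<in> Y" by blast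
        then have "a \<in> U'" using U_inner ab(2) nb by blast
        then have "a \<in> component_without G Y a"
          using component_without_self[of a G Y] U'(2) UV(2) torso_verts_subset by blast
        then have "d x \<le> d a"
          using next_strat[OF ab(1)] x(2) unfolding stratified_position_def robber_space_def by simp
        moreover have "d a < bottom d C" by (rule neighbours_lt_bottom[OF finite_C C(2) conjunct1[OF nb]])
        moreover have "bottom d C \<le> d x" using bottom_le[OF finite_C] x(1) by blast
        ultimately show False by simp
      qed
      then have "C \<subseteq> pverts G - X \<inter> Y" using C(1) by blast
      then show "b \<in> ?K"
        using component_through[OF Cc _ _ _ adj_sym ab(1) b] nb by blast
    qed (use component_without_step[OF ab(1) _ b] in blast)
  qed
  then show ?thesis by blast
qed

text \<open>If no \<open>k\<close> torso vertices cover \<open>\<B>\<close>, every cop set misses a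
  bramble set, and the robber can always move to one missed by the announced set. This produces an
  infinite play.\<close>

theorem winning_cops_cover_bramble:
  assumes win: "winning_strategy G d k \<sigma>"
  shows "\<exists>X \<subseteq> torso_verts (adj G) d C. covers X \<B> \<and> card X \<le> k"
proof (rule ccontr)
  assume no: "\<not> ?thesis"
  have free: "\<exists>U \<in> \<B>. U \<inter> \<sigma> ps = {}" for ps
  proof -
    have "\<sigma> ps \<subseteq> pverts G" "card (\<sigma> ps) \<le> k"
      using win unfolding winning_strategy_def strategy_for_def by blast+
    moreover have "finite (pverts G)" by (rule pair_graph_finite[OF G])
    ultimately have "card (\<sigma> ps \<inter> torso_verts (adj G) d C) \<le> k"
      by (meson Int_lower1 card_mono finite_subset le_trans)
    then have "\<not> covers (\<sigma> ps \<inter> torso_verts (adj G) d C) \<B>" using no by blast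
    then obtain U where "U \<in> \<B>" "\<sigma> ps \<inter> torso_verts (adj G) d C \<inter> U = {}"
      unfolding covers_def by blast
    moreover from this have "U \<subseteq> torso_verts (adj G) d C" using B unfolding bramble_def by blast
    ultimately show ?thesis by blast
  qed
  have strat: "stratified_position G d P" if "play G \<sigma> ps" "P \<in> set ps" for ps P
    using win that unfolding winning_strategy_def by blast
  define safe where "safe ps \<longleftrightarrow> play G \<sigma> ps \<and>
    (\<exists>qs X r. ps = qs @ [(X, r)] \<and> (\<exists>U \<in> \<B>. r \<in> U \<and> U \<inter> X = {}))" for ps
  \<comment> \<open>Dependent choice yields growing finite plays; fixing the length of
    \<open>f n\<close> makes their last positions the entries of one infinite play.\<close>
  have "\<exists>f. \<forall>n. (safe (f n) \<and> length (f n) = Suc n) \<and> (\<exists>P. f (Suc n) = f n @ [P])"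
  proof (rule dependent_nat_choice)
    obtain U where U: "U \<in> \<B>" "U \<inter> \<sigma> [] = {}" using free by blast
    then obtain r where r: "r \<in> U" using B unfolding bramble_def by blast
    then have "r \<in> pverts G - \<sigma> []" using U B torso_verts_subset unfolding bramble_def by blast
    then have "play G \<sigma> [(\<sigma> [], r)]" by (rule play_init)
    then have "safe [(\<sigma> [], r)]" unfolding safe_def using U r by blast
    then show "\<exists>ps. safe ps \<and> length ps = Suc 0" by (intro exI[of _ "[(\<sigma> [], r)]"]) simp
  next
    fix ps n assume ps: "safe ps \<and> length ps = Suc n"
    then obtain qs X r U where qs: "ps = qs @ [(X, r)]" "U \<in> \<B>" "r \<in> U" "U \<inter> X = {}"
      and play: "play G \<sigma> (qs @ [(X, r)])"
      unfolding safe_def by blast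
    define Y where "Y = \<sigma> (qs @ [(X, r)])"
    have not_captured: "\<not> captured (X, r)" using qs unfolding captured_def by auto
    have step: "play G \<sigma> (qs @ [(X, r), (Y, a)])" if "a \<in> component_without G (X \<inter> Y) r" for a
      by (rule play_step[OF play not_captured Y_def that])
    obtain U' where U': "U' \<in> \<B>" "U' \<inter> Y = {}" using free unfolding Y_def by blast
    have "U' \<subseteq> component_without G (X \<inter> Y) r"
    proof (rule robber_reaches_bramble_set[OF _ _ qs(2-4) U'])
      show "stratified_position G d (X, r)" by (rule strat[OF play]) simp
      show "stratified_position G d (Y, a)" if "a \<in> component_without G (X \<inter> Y) r" for a
        by (rule strat[OF step[OF that]]) simp
    qed
    moreover obtain a where a: "a \<in> U'" using U'(1) B unfolding bramble_def by blast
    ultimately have "play G \<sigma> (ps @ [(Y, a)])" using step[of a] qs(1) by auto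
    then have "safe (ps @ [(Y, a)])" unfolding safe_def using U' a by blast
    then show "\<exists>qs. (safe qs \<and> length qs = Suc (Suc n)) \<and> (\<exists>P. qs = ps @ [P])"
      using ps by (intro exI[of _ "ps @ [(Y, a)]"]) simp
  qed
  then obtain f where f: "\<And>n. safe (f n)" "\<And>n. length (f n) = Suc n" "\<And>n. \<exists>P. f (Suc n) = f n @ [P]"
    by blast
  define p where "p n = last (f n)" for n
  have "map p [0..<Suc n] = f n" for n
  proof (induction n)
    case 0
    then show ?case using f(2)[of 0] unfolding p_def by (cases "f 0") auto
  next
    case (Suc n)
    obtain P where "f (Suc n) = f n @ [P]" using f(3) by blast
    then show ?case using Suc unfolding p_def by simp
  qed
  then have "infinite_play G \<sigma> p"
    using f(1) unfolding infinite_play_def safe_def by simp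
  then show False using win unfolding winning_strategy_def by blast
qed

end

section \<open>The cops' side: a monotone chase down a tree\<close>

text \<open>
  \<open>below t\<close> is the territory left to the robber when the cops sit on the bag of \<open>t\<close>; the cops
  follow her into the child whose territory contains her.
\<close>

locale search_tree =
  fixes G :: "'a pair_pre_digraph" and d :: "'a \<Rightarrow> nat" and k :: nat and N :: "'t set" and root :: 't
    and child :: "'t \<Rightarrow> 't \<Rightarrow> bool" and bag below :: "'t \<Rightarrow> 'a set"
  assumes root: "root \<in> N" "below root = pverts G"
    and child_node: "\<And>t t'. t \<in> N \<Longrightarrow> child t t' \<Longrightarrow> t' \<in> N"
    and no_branch: "\<nexists>f. f (0 :: nat) = root \<and> (\<forall>n. child (f n) (f (Suc n)))"
    and bag: "\<And>t. t \<in> N \<Longrightarrow> bag t \<subseteq> pverts G \<and> card (bag t) \<le> k"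
    and follow: "\<And>t r. t \<in> N \<Longrightarrow> r \<in> below t - bag t \<Longrightarrow> \<exists>t'. child t t' \<and> r \<in> below t'"
    and guard: "\<And>t t'. t \<in> N \<Longrightarrow> child t t' \<Longrightarrow> below t' \<inter> bag t \<subseteq> bag t'"
    and closed: "\<And>t t' a b. t \<in> N \<Longrightarrow> child t t' \<Longrightarrow> a \<in> below t' - bag t \<Longrightarrow> (a, b) \<in> parcs G \<Longrightarrow> b \<in> below t'"
    and strat: "\<And>t x r. t \<in> N \<Longrightarrow> x \<in> bag t \<Longrightarrow> r \<in> below t - bag t \<Longrightarrow> d x \<le> d r"
begin

text \<open>The fallback \<open>root\<close> keeps \<open>node\<close> inside \<open>N\<close> on
  every list of positions, as \<open>strategy_for\<close> constrains the strategy on all lists and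
  not only on plays.\<close>

definition step_to :: "'t \<Rightarrow> 'a \<Rightarrow> 't" where
  "step_to t r = (if \<exists>t'. child t t' \<and> r \<in> below t' then SOME t'. child t t' \<and> r \<in> below t' else root)"

definition node :: "'a position list \<Rightarrow> 't" where
  "node ps = foldl (\<lambda>t P. step_to t (snd P)) root ps"

definition chase :: "'a cop_strategy" where
  "chase ps = bag (node ps)"

definition confined :: "'t \<Rightarrow> 'a \<Rightarrow> bool" where
  "confined t r \<longleftrightarrow> r \<in> bag t \<or> r \<in> below t \<and> robber_space G (bag t, r) \<subseteq> below t - bag t"

lemma step_to:
  assumes "t \<in> N" "r \<in> below t - bag t"
  shows "child t (step_to t r)" "r \<in> below (step_to t r)"
  using someI_ex[OF follow[OF assms]] follow[OF assms] unfolding step_to_def by auto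

lemma step_to_node: "t \<in> N \<Longrightarrow> step_to t r \<in> N"
  using someI_ex[of "\<lambda>t'. child t t' \<and> r \<in> below t'"] child_node root(1) unfolding step_to_def by auto

lemma node_in: "node ps \<in> N"
  by (induction ps rule: rev_induct) (auto simp: node_def root step_to_node)

lemma node_snoc: "node (ps @ [(X, r)]) = step_to (node ps) r"
  by (simp add: node_def)

text \<open>The cops who stay put already seal the territory of the child \<open>t'\<close>: by
  \<open>closed\<close>, an edge leaving \<open>below t' - bag t\<close> ends in
  \<open>below t'\<close> on a vertex of \<open>bag t\<close>, and \<open>guard\<close> puts that
  vertex into both bags. So neither the robber's move nor her new space gets out.\<close>

lemma chase_step:
  assumes t: "t \<in> N" and r: "r \<notin> bag t" "confined t r"
    and r': "r' \<in> component_without G (bag t \<inter> bag (step_to t r)) r"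
  shows "confined (step_to t r) r'"
    "robber_space G (bag (step_to t r), r') \<subseteq> robber_space G (bag t, r)"
proof -
  define t' where "t' = step_to t r"
  have rW: "r \<in> below t - bag t" using r unfolding confined_def by blast
  have ch: "child t t'" "r \<in> below t'" using step_to[OF t rW] unfolding t'_def by blast+
  have closed': "b \<in> below t' - bag t" if "a \<in> below t' - bag t" "(a, b) \<in> parcs G" "b \<notin> bag t \<inter> bag t'" for a b
    using closed[OF t ch(1) that(1,2)] guard[OF t ch(1)] that(3) by blast
  have move: "v \<in> below t' - bag t \<and> v \<in> component_without G (bag t) r"
    if "v \<in> component_without G (bag t \<inter> bag t') r" for v
    using that
  proof (induction rule: component_without_induct)
    case base
    then show ?case
      using ch r(1) component_without_self[of r G "bag t"] component_without_start[OF r'] by blast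
  next
    case (step a b)
    then show ?case
      using closed'[of a b] component_without_step[of a G "bag t" r b] by blast
  qed
  have space: "v \<in> below t' - bag t \<and> v \<in> component_without G (bag t) r"
    if "v \<in> component_without G (bag t') r'" for v
    using that
  proof (induction rule: component_without_induct)
    case base
    then show ?case using move r' unfolding t'_def by blast
  next
    case (step a b)
    then show ?case
      using closed'[of a b] component_without_step[of a G "bag t" r b] by blast
  qed
  show "robber_space G (bag (step_to t r), r') \<subseteq> robber_space G (bag t, r)"
    using space unfolding robber_space_def t'_def by auto
  have "r' \<in> below t'" using move r' unfolding t'_def by blast
  moreover have "robber_space G (bag t', r') \<subseteq> below t' - bag t'"
    using space component_without_subset[of G "bag t'" r'] unfolding robber_space_def by auto
  ultimately show "confined (step_to t r) r'" unfolding confined_def t'_def by blast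
qed

lemma chase_confined:
  assumes "play G chase ps"
  shows "\<exists>qs r. ps = qs @ [(bag (node qs), r)] \<and> confined (node qs) r"
  using assms
proof (induction rule: play.induct)
  case (play_init r)
  have "confined (node []) r"
    using play_init component_without_subset[of G "bag root" r] root(2)
    unfolding confined_def node_def chase_def robber_space_def by auto
  then show ?case unfolding chase_def by (intro exI[of _ "[]"]) simp
next
  case (play_step ps X r Y r')
  then have X: "X = bag (node ps)" "confined (node ps) r" by auto
  have Y: "Y = bag (step_to (node ps) r)" using play_step.hyps(3) unfolding chase_def node_snoc by simp
  have "confined (step_to (node ps) r) r'"
    by (rule chase_step(1)[OF node_in]) (use play_step X Y in \<open>auto simp: captured_def\<close>)
  then show ?case using Y node_snoc[of ps X r]
    by (intro exI[of _ "ps @ [(X, r)]"] exI[of _ r']) simp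
qed

lemma chase_last_strat:
  assumes "confined (node qs) r"
  shows "stratified_position G d (bag (node qs), r)"
  unfolding stratified_position_def
proof (intro ballI)
  fix x v assume xv: "x \<in> fst (bag (node qs), r)" "v \<in> robber_space G (bag (node qs), r)"
  then have "r \<notin> bag (node qs)" unfolding robber_space_def using component_without_start by fastforce
  then have "v \<in> below (node qs) - bag (node qs)" using assms xv(2) unfolding confined_def by blast
  then show "d x \<le> d v" using strat[OF node_in] xv(1) by simp
qed

lemma chase_invariants:
  assumes "play G chase ps"
  shows "(\<forall>P \<in> set ps. stratified_position G d P) \<and>
    (\<forall>i. Suc i < length ps \<longrightarrow> robber_space G (ps ! Suc i) \<subseteq> robber_space G (ps ! i))"
  using assms
proof (induction rule: play.induct)
  case (play_init r)
  have "play G chase [(chase [], r)]" using play_init by (rule play.play_init)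
  from chase_confined[OF this] show ?case using chase_last_strat by auto
next
  case (play_step ps X r Y r')
  have X: "X = bag (node ps)" "confined (node ps) r" using chase_confined[OF play_step.hyps(1)] by auto
  have Y: "Y = bag (step_to (node ps) r)" using play_step.hyps(3) unfolding chase_def node_snoc by simp
  have "play G chase (ps @ [(X, r), (Y, r')])" using play_step.hyps by (rule play.play_step)
  from chase_confined[OF this] have new: "stratified_position G d (Y, r')" using chase_last_strat by auto
  have mono: "robber_space G (Y, r') \<subseteq> robber_space G (X, r)"
    unfolding X Y by (rule chase_step(2)[OF node_in]) (use play_step X Y in \<open>auto simp: captured_def\<close>)
  have eq: "ps @ [(X, r), (Y, r')] = (ps @ [(X, r)]) @ [(Y, r')]" by simp
  show ?case
  proof (intro conjI allI impI)
    show "\<forall>P \<in> set (ps @ [(X, r), (Y, r')]). stratified_position G d P" using play_step.IH new by auto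
    fix i assume i: "Suc i < length (ps @ [(X, r), (Y, r')])"
    show "robber_space G ((ps @ [(X, r), (Y, r')]) ! Suc i) \<subseteq> robber_space G ((ps @ [(X, r), (Y, r')]) ! i)"
    proof (cases "i = length ps")
      case True
      then show ?thesis using mono by (simp add: nth_append)
    next
      case False
      then have "Suc i < length (ps @ [(X, r)])" using i by simp
      then show ?thesis using play_step.IH unfolding eq by (simp only: nth_append if_True Suc_lessD)
    qed
  qed
qed

theorem chase_wins: "winning_strategy G d k chase" "monotone_strategy G chase"
proof -
  show "monotone_strategy G chase" unfolding monotone_strategy_def using chase_invariants by blast
  have "False" if inf: "infinite_play G chase p" for p
  proof -
    define f where "f n = node (map p [0..<n])" for n
    have "child (f n) (f (Suc n))" for n
    proof -
      have "play G chase (map p [0..<Suc n])" using inf unfolding infinite_play_def by blast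
      then have pn: "fst (p n) = bag (f n)" "confined (f n) (snd (p n))"
        using chase_confined unfolding f_def by fastforce+
      \<comment> \<open>One further position shows that position \<open>n\<close> was no capture: a
        list of length at least two arises only by \<open>play_step\<close>, whose premise says
        so.\<close>
      have "play G chase (map p [0..<Suc (Suc n)])" using inf unfolding infinite_play_def by blast
      then have "\<not> captured (p n)"
      proof (cases rule: play.cases)
        case (play_step ps X r Y r')
        then have "map p [0..<n] @ [p n, p (Suc n)] = ps @ [(X, r), (Y, r')]" by simp
        then show ?thesis using play_step by (simp add: append_eq_append_conv2) (auto simp: append_eq_Cons_conv)
      qed simp
      then have "snd (p n) \<in> below (f n) - bag (f n)" using pn unfolding captured_def confined_def by auto
      then have "child (f n) (step_to (f n) (snd (p n)))"
        by (intro step_to(1)) (auto simp: f_def node_in)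
      moreover have "f (Suc n) = step_to (f n) (snd (p n))"
        unfolding f_def using node_snoc[of "map p [0..<n]" "fst (p n)" "snd (p n)"] by simp
      ultimately show ?thesis by simp
    qed
    moreover have "f 0 = root" unfolding f_def node_def by simp
    ultimately show False using no_branch by blast
  qed
  then show "winning_strategy G d k chase"
    unfolding winning_strategy_def strategy_for_def
    using chase_invariants bag[OF node_in] by (auto simp: chase_def)
qed

end

subsection \<open>Rooted trees\<close>

locale rooted_digraph_tree = pair_fin_digraph T for T :: "'t pair_pre_digraph" +
  fixes r :: 't
  assumes root_node: "r \<in> pverts T"
    and unique_awalk: "\<And>t. t \<in> pverts T \<Longrightarrow> \<exists>!p. awalk r p t"
begin

lemma awalk_arc: "(s, t) \<in> parcs T \<Longrightarrow> awalk s [(s, t)] t"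
  by (simp add: awalk_Cons_iff awalk_Nil_iff in_arcsD2)

lemma awalk_snoc: "awalk r p s \<Longrightarrow> (s, t) \<in> parcs T \<Longrightarrow> awalk r (p @ [(s, t)]) t"
  by (rule awalk_appendI[OF _ awalk_arc])

lemma awalk_eq: "awalk r p t \<Longrightarrow> awalk r q t \<Longrightarrow> p = q"
  using unique_awalk[of t] by (metis awalk_last_in_verts)

lemma reachable_root: "t \<in> pverts T \<Longrightarrow> r \<rightarrow>\<^sup>*\<^bsub>T\<^esub> t"
  using unique_awalk[of t] reachable_awalk by blast

lemma unique_parent:
  assumes "(s, t) \<in> parcs T" "(s', t) \<in> parcs T"
  shows "s = s'"
proof -
  obtain p q where "awalk r p s" "awalk r q s'"
    using unique_awalk[OF in_arcsD1[OF assms(1)]] unique_awalk[OF in_arcsD1[OF assms(2)]] by blast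
  then have "p @ [(s, t)] = q @ [(s', t)]" using awalk_snoc assms awalk_eq by blast
  then show ?thesis by simp
qed

text \<open>A closed walk through \<open>s\<close> would give two different walks from the root to
  \<open>s\<close>.\<close>

lemma no_way_back:
  assumes "(s, t) \<in> parcs T" "t \<rightarrow>\<^sup>*\<^bsub>T\<^esub> s"
  shows False
proof -
  obtain p q where p: "awalk r p s" "awalk t q s"
    using unique_awalk[OF in_arcsD1[OF assms(1)]] assms(2) reachable_awalk by blast
  then have "awalk r ((p @ [(s, t)]) @ q) s" using awalk_appendI[OF awalk_snoc] assms(1) by blast
  then have "p = (p @ [(s, t)]) @ q" using awalk_eq p(1) by blast
  then show False by (metis append_assoc append_self_conv append_is_Nil_conv not_Cons_self2)
qed

lemma reachable_antisym:
  assumes "s \<rightarrow>\<^sup>*\<^bsub>T\<^esub> t" "t \<rightarrow>\<^sup>*\<^bsub>T\<^esub> s"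
  shows "s = t"
  using assms(1)
proof (cases rule: converse_reachable_cases)
  case (step w)
  then show ?thesis using no_way_back[of s w] reachable_trans[OF step(2) assms(2)] by simp
qed

text \<open>Different indices on a branch give walks of different lengths from the root, hence
  different nodes, while the tree is finite.\<close>

lemma no_infinite_branch: "\<nexists>f. f (0 :: nat) = r \<and> (\<forall>n. (f n, f (Suc n)) \<in> parcs T)"
proof
  assume "\<exists>f. f (0 :: nat) = r \<and> (\<forall>n. (f n, f (Suc n)) \<in> parcs T)"
  then obtain f where f: "f (0 :: nat) = r" "\<And>n. (f n, f (Suc n)) \<in> parcs T" by blast
  have walk: "awalk r (map (\<lambda>i. (f i, f (Suc i))) [0..<n]) (f n)" for n
  proof (induction n)
    case 0
    then show ?case using f root_node by (simp add: awalk_Nil_iff)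
  next
    case (Suc n)
    then show ?case using awalk_snoc[OF Suc f(2)] by simp
  qed
  have "inj f"
  proof (rule injI)
    fix m n assume "f m = f n"
    then have "map (\<lambda>i. (f i, f (Suc i))) [0..<m] = map (\<lambda>i. (f i, f (Suc i))) [0..<n]"
      using walk[of m] walk[of n] awalk_eq by metis
    then have "length (map (\<lambda>i. (f i, f (Suc i))) [0..<m]) = length (map (\<lambda>i. (f i, f (Suc i))) [0..<n])"
      by (rule arg_cong)
    then show "m = n" by simp
  qed
  moreover have "range f \<subseteq> pverts T" using in_arcsD1[OF f(2)] by blast
  ultimately show False using pair_finite_verts finite_subset finite_imageD by blast
qed

lemma connected_closed:
  assumes conn: "Digraph_Component.connected (with_proj T \<restriction> Q)" and PQ: "P \<inter> Q \<noteq> {}"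
    and closed: "\<And>a b. (a, b) \<in> parcs T \<Longrightarrow> a \<in> Q \<Longrightarrow> b \<in> Q \<Longrightarrow> a \<in> P \<longleftrightarrow> b \<in> P"
  shows "Q \<subseteq> P"
proof
  fix q assume q: "q \<in> Q"
  obtain s where s: "s \<in> P" "s \<in> Q" using PQ by blast
  have "(s, q) \<in> rtrancl_on Q (parcs (mk_symmetric (with_proj T \<restriction> Q)))"
    using conn s q
    unfolding Digraph_Component.connected_def strongly_connected_def reachable_def by simp
  then show "q \<in> P"
  proof (induction rule: rtrancl_on_induct)
    case (step y z)
    then have "(y, z) \<in> parcs T \<or> (z, y) \<in> parcs T" by (auto simp: parcs_mk_symmetric)
    then show ?case using closed step by blast
  qed (rule s(1))
qed

text \<open>The arc from \<open>s\<close> is the only one entering the subtree at \<open>t\<close>,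
  and \<open>Q\<close> avoids \<open>s\<close>; so no tree edge inside \<open>Q\<close> crosses the
  border of that subtree.\<close>

lemma connected_below_child:
  assumes conn: "Digraph_Component.connected (with_proj T \<restriction> Q)"
    and st: "(s, t) \<in> parcs T" "s \<notin> Q" and q: "q \<in> Q" "t \<rightarrow>\<^sup>*\<^bsub>T\<^esub> q"
  shows "Q \<subseteq> {u. t \<rightarrow>\<^sup>*\<^bsub>T\<^esub> u}"
proof (rule connected_closed[OF conn])
  show "{u. t \<rightarrow>\<^sup>*\<^bsub>T\<^esub> u} \<inter> Q \<noteq> {}" using q by blast
  fix a b assume ab: "(a, b) \<in> parcs T" "a \<in> Q" "b \<in> Q"
  have "t \<rightarrow>\<^sup>*\<^bsub>T\<^esub> a" if "t \<rightarrow>\<^sup>*\<^bsub>T\<^esub> b"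
    using that ab
  proof (induction rule: reachable_induct)
    case base
    then show ?case using unique_parent[OF st(1)] st(2) by blast
  next
    case (step x y)
    then have "x = a" using unique_parent[of x y a] by simp
    then show ?case using step by simp
  qed
  moreover have "t \<rightarrow>\<^sup>*\<^bsub>T\<^esub> b" if "t \<rightarrow>\<^sup>*\<^bsub>T\<^esub> a" using reachable_adj_trans[OF that] ab(1) by simp
  ultimately show "a \<in> {u. t \<rightarrow>\<^sup>*\<^bsub>T\<^esub> u} \<longleftrightarrow> b \<in> {u. t \<rightarrow>\<^sup>*\<^bsub>T\<^esub> u}" by blast
qed

text \<open>A node of least depth works: its parent, if any, is less deep and so outside
  \<open>Q\<close>, which confines \<open>Q\<close> to the subtree.\<close>

lemma connected_least_node:
  assumes conn: "Digraph_Component.connected (with_proj T \<restriction> Q)" and "Q \<subseteq> pverts T"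
  shows "\<exists>m \<in> Q. \<forall>q \<in> Q. m \<rightarrow>\<^sup>*\<^bsub>T\<^esub> q"
proof -
  define depth where "depth t = length (THE p. awalk r p t)" for t
  have depth: "depth t = length p" if "awalk r p t" for p t
    unfolding depth_def using that awalk_eq by (metis (mono_tags) the_equality)
  have "Q \<noteq> {}" using conn unfolding Digraph_Component.connected_def strongly_connected_def by simp
  then obtain m where m: "m \<in> Q" "\<And>q. q \<in> Q \<Longrightarrow> depth m \<le> depth q"
    using ex_has_least_nat[of "\<lambda>m. m \<in> Q" _ depth] by blast
  obtain p where p: "awalk r p m" using unique_awalk m assms(2) by blast
  show ?thesis
  proof (cases p rule: rev_cases)
    case Nil
    then have "m = r" using p by (simp add: awalk_Nil_iff)
    then show ?thesis using m(1) reachable_root assms(2) by blast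
  next
    case (snoc q e)
    then obtain s where s: "awalk r q s" "(s, m) \<in> parcs T"
      using p by (cases e) (auto simp: awalk_Cons_iff awalk_Nil_iff)
    have "depth s < depth m" using depth[OF s(1)] depth[OF p] snoc by simp
    then have "s \<notin> Q" using m(2) by force
    then show ?thesis
      using connected_below_child[OF conn s(2) _ m(1)] m(1) assms(2) by blast
  qed
qed

end

lemma rooted_digraph_tree: "rooted_tree T r \<Longrightarrow> rooted_digraph_tree T r"
  unfolding rooted_tree_def rooted_digraph_tree_def rooted_digraph_tree_axioms_def by blast

section \<open>From a stratified tree decomposition to a search tree\<close>

locale decomposition_tree =
  fixes G :: "'a pair_pre_digraph" and T :: "'t pair_pre_digraph" and r :: 't and B :: "'t \<Rightarrow> 'a set"
  assumes decomposition: "tree_decomposition G T r B"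

sublocale decomposition_tree \<subseteq> rooted_digraph_tree T r
  by (rule rooted_digraph_tree) (use decomposition in \<open>simp add: tree_decomposition_def\<close>)

context decomposition_tree
begin

lemma bag_subset: "t \<in> pverts T \<Longrightarrow> B t \<subseteq> pverts G"
  using decomposition unfolding tree_decomposition_def by blast

lemma vertex_in_bag: "v \<in> pverts G \<Longrightarrow> \<exists>t \<in> pverts T. v \<in> B t"
  using decomposition unfolding tree_decomposition_def by blast

lemma edge_in_bag: "(u, v) \<in> parcs G \<Longrightarrow> \<exists>t \<in> pverts T. u \<in> B t \<and> v \<in> B t"
  using decomposition unfolding tree_decomposition_def by blast

lemma bags_connected:
  "v \<in> pverts G \<Longrightarrow> Digraph_Component.connected (with_proj T \<restriction> {t \<in> pverts T. v \<in> B t})"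
  using decomposition unfolding tree_decomposition_def by blast

lemma top_node:
  assumes "v \<in> pverts G"
  shows "top_node T B v \<in> pverts T" "v \<in> B (top_node T B v)"
    and top_node_least: "\<And>t. t \<in> pverts T \<Longrightarrow> v \<in> B t \<Longrightarrow> top_node T B v \<rightarrow>\<^sup>*\<^bsub>T\<^esub> t"
proof -
  obtain m where m: "m \<in> pverts T" "v \<in> B m" "\<And>t. t \<in> pverts T \<Longrightarrow> v \<in> B t \<Longrightarrow> m \<rightarrow>\<^sup>*\<^bsub>T\<^esub> t"
    using connected_least_node[OF bags_connected[OF assms]] by blast
  have "top_node T B v = m"
    unfolding top_node_def
  proof (rule the_equality)
    have "\<not> tree_less T s m" if "s \<in> pverts T" "v \<in> B s" for s
      using reachable_antisym[OF m(3)[OF that]] unfolding tree_less_def by blast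
    then show "m \<in> pverts T \<and> v \<in> B m \<and> \<not> (\<exists>s \<in> pverts T. v \<in> B s \<and> tree_less T s m)"
      using m by blast
    show "t = m" if "t \<in> pverts T \<and> v \<in> B t \<and> \<not> (\<exists>s \<in> pverts T. v \<in> B s \<and> tree_less T s t)" for t
      using that m unfolding tree_less_def by blast
  qed
  then show "top_node T B v \<in> pverts T" "v \<in> B (top_node T B v)"
    "\<And>t. t \<in> pverts T \<Longrightarrow> v \<in> B t \<Longrightarrow> top_node T B v \<rightarrow>\<^sup>*\<^bsub>T\<^esub> t"
    using m by simp_all
qed

definition verts_below :: "'t \<Rightarrow> 'a set" where
  "verts_below t = {v. \<exists>s. t \<rightarrow>\<^sup>*\<^bsub>T\<^esub> s \<and> v \<in> B s}"

lemma verts_below_child: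
  assumes "v \<in> verts_below t - B t"
  shows "\<exists>t'. (t, t') \<in> parcs T \<and> v \<in> verts_below t'"
proof -
  obtain s where s: "t \<rightarrow>\<^sup>*\<^bsub>T\<^esub> s" "v \<in> B s" "v \<notin> B t" using assms unfolding verts_below_def by blast
  from s(1) show ?thesis
  proof (cases rule: converse_reachable_cases)
    case base
    then show ?thesis using s by simp
  next
    case (step w)
    then show ?thesis using s(2) unfolding verts_below_def by auto
  qed
qed

lemma below_child_confined:
  assumes "(t, t') \<in> parcs T" "v \<in> verts_below t'" "v \<notin> B t" "s \<in> pverts T" "v \<in> B s"
  shows "t' \<rightarrow>\<^sup>*\<^bsub>T\<^esub> s"
proof -
  obtain q where q: "t' \<rightarrow>\<^sup>*\<^bsub>T\<^esub> q" "v \<in> B q" using assms(2) unfolding verts_below_def by blast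
  have "v \<in> pverts G" using bag_subset assms(4,5) by blast
  from connected_below_child[OF bags_connected[OF this] assms(1) _ _ q(1)] show ?thesis
    using assms(3-5) q reachable_in_verts(2)[OF q(1)] by blast
qed

text \<open>Otherwise all nodes whose bags contain \<open>v\<close> lie below some child of
  \<open>t'\<close>, and \<open>t\<close> cannot be among them.\<close>

lemma guard_child:
  assumes "(t, t') \<in> parcs T" "v \<in> verts_below t'" "v \<in> B t"
  shows "v \<in> B t'"
proof (rule ccontr)
  assume nv: "v \<notin> B t'"
  then obtain c where c: "(t', c) \<in> parcs T" "v \<in> verts_below c"
    using verts_below_child assms(2) by blast
  have "c \<rightarrow>\<^sup>*\<^bsub>T\<^esub> t" by (rule below_child_confined[OF c nv in_arcsD1[OF assms(1)] assms(3)])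
  then have "c \<rightarrow>\<^sup>*\<^bsub>T\<^esub> t'" using reachable_adj_trans assms(1) by simp
  then show False using no_way_back[OF c(1)] by blast
qed

text \<open>Translates from top nodes to bags: the top node of \<open>x\<close> is at or above
  \<open>t\<close>, that of \<open>v\<close> at or below a child of \<open>t\<close>, so the first
  strictly precedes the second.\<close>

lemma stratified_below:
  assumes "stratified_decomposition G d T B" "t \<in> pverts T" "x \<in> B t" "v \<in> verts_below t - B t"
  shows "d x \<le> d v"
proof -
  obtain t' where t': "(t, t') \<in> parcs T" "v \<in> verts_below t'" using verts_below_child assms(4) by blast
  have xG: "x \<in> pverts G" using bag_subset assms(2,3) by blast
  obtain s where "t' \<rightarrow>\<^sup>*\<^bsub>T\<^esub> s" "v \<in> B s" using t'(2) unfolding verts_below_def by blast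
  then have vG: "v \<in> pverts G" using bag_subset reachable_in_verts(2) by blast
  have 1: "top_node T B x \<rightarrow>\<^sup>*\<^bsub>T\<^esub> t" by (rule top_node_least[OF xG assms(2,3)])
  have 2: "t' \<rightarrow>\<^sup>*\<^bsub>T\<^esub> top_node T B v"
    using below_child_confined[OF t' _ top_node(1,2)[OF vG]] assms(4) by blast
  have 3: "top_node T B x \<rightarrow>\<^sup>*\<^bsub>T\<^esub> t'" using reachable_adj_trans[OF 1] t'(1) by simp
  have "top_node T B x \<noteq> top_node T B v"
    using no_way_back[OF t'(1)] reachable_trans[OF 2] 1 by metis
  then have "tree_less T (top_node T B x) (top_node T B v)"
    unfolding tree_less_def using reachable_trans[OF 3 2] by blast
  then show ?thesis using assms(1) xG vG unfolding stratified_decomposition_def by blast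
qed

lemma search_tree:
  assumes "stratified_decomposition G d T B" "\<And>t. t \<in> pverts T \<Longrightarrow> card (B t) \<le> k"
  shows "search_tree G d k (pverts T) r (\<lambda>t t'. (t, t') \<in> parcs T) B verts_below"
proof
  show "r \<in> pverts T" by (rule root_node)
  show "verts_below r = pverts G"
  proof
    show "verts_below r \<subseteq> pverts G"
      unfolding verts_below_def using bag_subset reachable_in_verts(2) by blast
    show "pverts G \<subseteq> verts_below r"
      unfolding verts_below_def using vertex_in_bag reachable_root by blast
  qed
  show "\<nexists>f. f (0 :: nat) = r \<and> (\<forall>n. (f n, f (Suc n)) \<in> parcs T)" by (rule no_infinite_branch)
  show "b \<in> verts_below t'"
    if ab: "(t, t') \<in> parcs T" "a \<in> verts_below t' - B t" "(a, b) \<in> parcs G" for t t' a b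
  proof -
    obtain q where q: "q \<in> pverts T" "a \<in> B q" "b \<in> B q" using edge_in_bag[OF ab(3)] by blast
    then have "t' \<rightarrow>\<^sup>*\<^bsub>T\<^esub> q" using below_child_confined[OF ab(1)] ab(2) by blast
    then show ?thesis unfolding verts_below_def using q(3) by blast
  qed
  show "d x \<le> d v" if "t \<in> pverts T" "x \<in> B t" "v \<in> verts_below t - B t" for t x v
    by (rule stratified_below[OF assms(1) that])
  show "\<exists>t'. (t, t') \<in> parcs T \<and> v \<in> verts_below t'" if "v \<in> verts_below t - B t" for t v
    by (rule verts_below_child[OF that])
  show "verts_below t' \<inter> B t \<subseteq> B t'" if "(t, t') \<in> parcs T" for t t'
    using guard_child[OF that] by blast
  show "B t \<subseteq> pverts G \<and> card (B t) \<le> k" if "t \<in> pverts T" for t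
    using bag_subset assms(2) that by blast
  show "t' \<in> pverts T" if "(t, t') \<in> parcs T" for t t' by (rule in_arcsD2[OF that])
qed

end

subsection \<open>Trees given by parent functions\<close>

text \<open>With parents numbered before children (\<open>p i < i\<close>), the node number serves
  as induction measure, and attaching a tree amounts to shifting a block of indices.\<close>

definition parent_arcs :: "nat \<Rightarrow> (nat \<Rightarrow> nat) \<Rightarrow> nat rel" where
  "parent_arcs n p = {(p j, j) | j. 0 < j \<and> j < n}"

definition parent_tree :: "nat \<Rightarrow> (nat \<Rightarrow> nat) \<Rightarrow> nat pair_pre_digraph" where
  "parent_tree n p = \<lparr>pverts = {..<n}, parcs = parent_arcs n p\<rparr>"

lemma parent_arcs_iff: "(i, j) \<in> parent_arcs n p \<longleftrightarrow> i = p j \<and> 0 < j \<and> j < n"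
  unfolding parent_arcs_def by auto

lemma root_reaches:
  assumes "\<And>i. 0 < i \<Longrightarrow> i < n \<Longrightarrow> p i < i"
  shows "j < n \<Longrightarrow> (0, j) \<in> (parent_arcs n p)\<^sup>*"
proof (induction j rule: less_induct)
  case (less j)
  show ?case
  proof (cases "j = 0")
    case False
    then have "p j < j" "p j < n" using assms less.prems by (auto intro: less_trans)
    then have "(0, p j) \<in> (parent_arcs n p)\<^sup>*" using less.IH by blast
    moreover have "(p j, j) \<in> parent_arcs n p" using False less.prems by (simp add: parent_arcs_iff)
    ultimately show ?thesis by (rule rtrancl_into_rtrancl)
  qed simp
qed

lemma parent_tree_fin:
  assumes "\<And>i. 0 < i \<Longrightarrow> i < n \<Longrightarrow> p i < i"
  shows "pair_fin_digraph (parent_tree n p)"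
proof
  have sub: "parent_arcs n p \<subseteq> {..<n} \<times> {..<n}"
  proof (rule subrelI)
    fix i j assume "(i, j) \<in> parent_arcs n p"
    then show "(i, j) \<in> {..<n} \<times> {..<n}" using assms[of j] by (simp add: parent_arcs_iff)
  qed
  then show "fst e \<in> pverts (parent_tree n p)" "snd e \<in> pverts (parent_tree n p)"
    if "e \<in> parcs (parent_tree n p)" for e
    using that unfolding parent_tree_def by auto
  show "finite (pverts (parent_tree n p))" unfolding parent_tree_def by simp
  show "finite (parcs (parent_tree n p))"
    unfolding parent_tree_def using finite_subset[OF sub] by simp
qed

text \<open>Read from its end, a walk from \<open>0\<close> has no choice: its last arc into
  \<open>t\<close> must be \<open>(p t, t)\<close>, and \<open>p t < t\<close> lets induction
  determine the rest.\<close>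

lemma parent_tree_rooted:
  assumes "0 < n" and p: "\<And>i. 0 < i \<Longrightarrow> i < n \<Longrightarrow> p i < i"
  shows "rooted_tree (parent_tree n p) 0"
proof -
  interpret pair_fin_digraph "parent_tree n p" by (rule parent_tree_fin[OF p])
  have verts: "pverts (parent_tree n p) = {..<n}" and arcs: "parcs (parent_tree n p) = parent_arcs n p"
    unfolding parent_tree_def by simp_all
  have ex: "\<exists>q. awalk 0 q t" if "t < n" for t
  proof -
    have "0 \<rightarrow>\<^sup>*\<^bsub>parent_tree n p\<^esub> t"
      using reachable_conv'[of 0 t] root_reaches[of n p t] p that assms(1) by (simp add: verts arcs)
    then show ?thesis by (simp add: reachable_awalk)
  qed
  have snoc: "\<exists>q'. q = q' @ [(p t, t)] \<and> awalk 0 q' (p t) \<and> 0 < t \<and> t < n"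
    if "awalk 0 q t" "q \<noteq> []" for q t
  proof -
    obtain q' e where q: "q = q' @ [e]" using \<open>q \<noteq> []\<close> by (cases q rule: rev_cases) auto
    obtain a b where e: "e = (a, b)" by (cases e)
    from \<open>awalk 0 q t\<close> have "awalk 0 q' a" "(a, b) \<in> parent_arcs n p" "b = t"
      unfolding q e by (auto simp: awalk_Cons_iff awalk_Nil_iff arcs)
    then show ?thesis unfolding q e by (simp add: parent_arcs_iff)
  qed
  have unique: "q = q'" if "awalk 0 q t" "awalk 0 q' t" for q q' t
    using that
  proof (induction t arbitrary: q q' rule: less_induct)
    case (less t)
    have nil: "t = 0" if "awalk 0 [] t" using that by (simp add: awalk_Nil_iff)
    show ?case
    proof (cases "q = [] \<or> q' = []")
      case True
      then have "t = 0" using nil less.prems by blast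
      then show ?thesis using snoc[OF less.prems(1)] snoc[OF less.prems(2)] by blast
    next
      case False
      then obtain u u' where u: "q = u @ [(p t, t)]" "awalk 0 u (p t)" "q' = u' @ [(p t, t)]"
        "awalk 0 u' (p t)" "0 < t" "t < n"
        using snoc[OF less.prems(1)] snoc[OF less.prems(2)] by blast
      then show ?thesis using less.IH[OF p[OF u(5,6)] u(2,4)] by simp
    qed
  qed
  show ?thesis
    unfolding rooted_tree_def
  proof (intro conjI ballI)
    show "pair_fin_digraph (parent_tree n p)" by (rule parent_tree_fin[OF p])
    show "0 \<in> pverts (parent_tree n p)" using assms(1) by (simp add: verts)
    show "\<exists>!q. awalk 0 q t" if "t \<in> pverts (parent_tree n p)" for t
      using ex[of t] unique that by (auto simp: verts)
  qed
qed

lemma parent_tree_connected: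
  assumes Q: "Q \<subseteq> {..<n}" "m \<in> Q" and p: "\<And>i. 0 < i \<Longrightarrow> i < n \<Longrightarrow> p i < i"
    and up: "\<And>i. i \<in> Q \<Longrightarrow> i \<noteq> m \<Longrightarrow> 0 < i \<and> p i \<in> Q"
  shows "Digraph_Component.connected (with_proj (parent_tree n p) \<restriction> Q)"
proof -
  let ?H = "mk_symmetric (with_proj (parent_tree n p) \<restriction> Q)"
  have arcs: "(a, b) \<in> parcs ?H" if "(a, b) \<in> parent_arcs n p \<or> (b, a) \<in> parent_arcs n p" "a \<in> Q" "b \<in> Q" for a b
    using that unfolding parcs_mk_symmetric by (force simp: parent_tree_def)
  have reach: "(m, i) \<in> rtrancl_on Q (parcs ?H)" if "i \<in> Q" for i
    using that
  proof (induction i rule: less_induct)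
    case (less i)
    show ?case
    proof (cases "i = m")
      case False
      then have i: "0 < i" "p i \<in> Q" "i < n" using up less.prems Q(1) by auto
      then have "(m, p i) \<in> rtrancl_on Q (parcs ?H)" using less.IH p by blast
      moreover have "(p i, i) \<in> parcs ?H" using arcs[of "p i" i] i less.prems by (simp add: parent_arcs_iff)
      ultimately show ?thesis using less.prems by (rule rtrancl_on_into_rtrancl_on)
    qed (use Q(2) in auto)
  qed
  have "sym (parcs ?H)" using symmetric_mk_symmetric unfolding symmetric_def by force
  then have "sym (rtrancl_on Q (parcs ?H))" by (rule rtrancl_on_sym)
  then have "(i, j) \<in> rtrancl_on Q (parcs ?H)" if "i \<in> Q" "j \<in> Q" for i j
    using rtrancl_on_trans[OF symD[of _ m i] reach[OF that(2)]] reach[OF that(1)] by blast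
  then show ?thesis
    unfolding Digraph_Component.connected_def strongly_connected_def reachable_def using Q(2) by auto
qed

text \<open>The clauses are in a form that survives concatenation of arrays. Connectedness of the
  nodes holding \<open>v\<close> says that all but one of them pass \<open>v\<close> to their
  parent; stratification compares bags along tree paths instead of top nodes.\<close>

definition array_decomp ::
    "('a \<Rightarrow> 'a \<Rightarrow> bool) \<Rightarrow> ('a \<Rightarrow> nat) \<Rightarrow> nat \<Rightarrow> 'a set \<Rightarrow> 'a set \<Rightarrow> nat \<Rightarrow> (nat \<Rightarrow> nat) \<Rightarrow>
      (nat \<Rightarrow> 'a set) \<Rightarrow> bool" where
  "array_decomp E d k X W n p B \<longleftrightarrow>
     0 < n \<and> (\<forall>i. 0 < i \<and> i < n \<longrightarrow> p i < i) \<and> B 0 = X \<and> (\<Union>i<n. B i) = W \<and>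
     (\<forall>i<n. card (B i) \<le> k) \<and>
     (\<forall>v \<in> W. \<exists>m<n. v \<in> B m \<and> (\<forall>i<n. v \<in> B i \<and> i \<noteq> m \<longrightarrow> 0 < i \<and> v \<in> B (p i))) \<and>
     (\<forall>a \<in> W. \<forall>b \<in> W. E a b \<longrightarrow> (\<exists>i<n. a \<in> B i \<and> b \<in> B i)) \<and>
     (\<forall>i j. i < n \<and> j < n \<and> (i, j) \<in> (parent_arcs n p)\<^sup>* \<longrightarrow>
       (\<forall>x \<in> B i. \<forall>r \<in> B j - B i. d x \<le> d r))"

lemma array_decompI:
  assumes "0 < n"
    "\<And>i. 0 < i \<Longrightarrow> i < n \<Longrightarrow> p i < i"
    "B 0 = X"
    "(\<Union>i<n. B i) = W"
    "\<And>i. i < n \<Longrightarrow> card (B i) \<le> k"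
    "\<And>v. v \<in> W \<Longrightarrow> \<exists>m<n. v \<in> B m \<and> (\<forall>i<n. v \<in> B i \<and> i \<noteq> m \<longrightarrow> 0 < i \<and> v \<in> B (p i))"
    "\<And>a b. a \<in> W \<Longrightarrow> b \<in> W \<Longrightarrow> E a b \<Longrightarrow> \<exists>i<n. a \<in> B i \<and> b \<in> B i"
    "\<And>i j x r. i < n \<Longrightarrow> j < n \<Longrightarrow> (i, j) \<in> (parent_arcs n p)\<^sup>* \<Longrightarrow> x \<in> B i \<Longrightarrow> r \<in> B j - B i \<Longrightarrow> d x \<le> d r"
  shows "array_decomp E d k X W n p B"
  using assms unfolding array_decomp_def by simp (metis DiffE)

lemma array_decompD:
  assumes "array_decomp E d k X W n p B"
  shows "0 < n"
    "\<And>i. 0 < i \<Longrightarrow> i < n \<Longrightarrow> p i < i"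
    "B 0 = X"
    "(\<Union>i<n. B i) = W"
    "\<And>i. i < n \<Longrightarrow> card (B i) \<le> k"
    "\<And>v. v \<in> W \<Longrightarrow> \<exists>m<n. v \<in> B m \<and> (\<forall>i<n. v \<in> B i \<and> i \<noteq> m \<longrightarrow> 0 < i \<and> v \<in> B (p i))"
    "\<And>a b. a \<in> W \<Longrightarrow> b \<in> W \<Longrightarrow> E a b \<Longrightarrow> \<exists>i<n. a \<in> B i \<and> b \<in> B i"
    "\<And>i j x r. i < n \<Longrightarrow> j < n \<Longrightarrow> (i, j) \<in> (parent_arcs n p)\<^sup>* \<Longrightarrow> x \<in> B i \<Longrightarrow> r \<in> B j - B i \<Longrightarrow> d x \<le> d r"
  using assms unfolding array_decomp_def by simp_all

lemma array_decomp_attach: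
  assumes 1: "array_decomp E d k X W n p B" and 2: "array_decomp E d k Y W' n' p' B'"
    and X: "W \<inter> W' \<subseteq> X" and Y: "W \<inter> W' \<subseteq> Y"
    and cross: "\<And>a b. a \<in> W - W' \<Longrightarrow> b \<in> W' - W \<Longrightarrow> \<not> E a b"
    and d: "\<And>x r. x \<in> X \<Longrightarrow> r \<in> W' - X \<Longrightarrow> d x \<le> d r"
    and sym: "\<And>a b. E a b \<Longrightarrow> E b a"
  shows "array_decomp E d k X (W \<union> W') (n + n')
    (\<lambda>j. if j < n then p j else if j = n then 0 else n + p' (j - n))
    (\<lambda>j. if j < n then B j else B' (j - n))"
    (is "array_decomp E d k X (W \<union> W') ?n ?p ?B")
proof -
  note n = array_decompD(1)[OF 1] array_decompD(1)[OF 2]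
    and p = array_decompD(2)[OF 1] array_decompD(2)[OF 2]
    and B0 = array_decompD(3)[OF 1] array_decompD(3)[OF 2]
    and W = array_decompD(4)[OF 1] array_decompD(4)[OF 2]
    and card = array_decompD(5)[OF 1] array_decompD(5)[OF 2]
    and top = array_decompD(6)[OF 1] and top' = array_decompD(6)[OF 2]
    and edge = array_decompD(7)[OF 1] and edge' = array_decompD(7)[OF 2]
    and strat = array_decompD(8)[OF 1] and strat' = array_decompD(8)[OF 2]
  have sub: "B i \<subseteq> W" if "i < n" for i using that W(1) by blast
  have sub': "B' i \<subseteq> W'" if "i < n'" for i using that W(2) by blast
  have diff: "i - n < n'" if "i < ?n" "\<not> i < n" for i using that by linarith
  have c1: "?p i < i" if "0 < i" "i < ?n" for i
  proof -
    consider "i < n" | "i = n" | "n < i" by linarith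
    then show ?thesis
    proof cases
      case 3
      then have "p' (i - n) < i - n" using p(2)[of "i - n"] diff[of i] that by simp
      then show ?thesis using 3 by simp
    qed (use p(1)[of i] that n in simp_all)
  qed
  have c2: "(\<Union>i<?n. ?B i) = W \<union> W'"
  proof
    show "(\<Union>i<?n. ?B i) \<subseteq> W \<union> W'"
    proof
      fix v assume "v \<in> (\<Union>i<?n. ?B i)"
      then obtain i where i: "i < ?n" "v \<in> ?B i" by blast
      then show "v \<in> W \<union> W'" using sub[of i] sub'[OF diff[of i]] by (cases "i < n") auto
    qed
    show "W \<union> W' \<subseteq> (\<Union>i<?n. ?B i)"
    proof
      fix v assume "v \<in> W \<union> W'"
      then consider i where "i < n" "v \<in> B i" | i where "i < n'" "v \<in> B' i" using W by blast
      then show "v \<in> (\<Union>i<?n. ?B i)"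
      proof cases
        case (1 i)
        then show ?thesis by (intro UN_I[of i]) auto
      next
        case (2 i)
        then show ?thesis by (intro UN_I[of "n + i"]) auto
      qed
    qed
  qed
  have c3: "card (?B i) \<le> k" if "i < ?n" for i using card(1)[of i] card(2)[OF diff[of i]] that by auto
  have c4: "\<exists>m<?n. v \<in> ?B m \<and> (\<forall>i<?n. v \<in> ?B i \<and> i \<noteq> m \<longrightarrow> 0 < i \<and> v \<in> ?B (?p i))"
    if v: "v \<in> W \<union> W'" for v
  proof (cases "v \<in> W")
    case True
    obtain m where m: "m < n" "v \<in> B m" "\<And>i. i < n \<Longrightarrow> v \<in> B i \<Longrightarrow> i \<noteq> m \<Longrightarrow> 0 < i \<and> v \<in> B (p i)"
      using top[OF True] by blast
    have "0 < i \<and> v \<in> ?B (?p i)" if i: "i < ?n" "v \<in> ?B i" "i \<noteq> m" for i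
    proof (cases "i < n")
      case True
      then show ?thesis using m(3)[of i] i p(1)[of i] by auto
    next
      case False
      then have vi: "i - n < n'" "v \<in> B' (i - n)" using i diff[of i] by auto
      then have vXY: "v \<in> X" "v \<in> Y" using sub' \<open>v \<in> W\<close> X Y by blast+
      show ?thesis
      proof (cases "i = n")
        case True
        then show ?thesis using n vXY B0 by simp
      next
        case False
        obtain m' where m': "\<And>i. i < n' \<Longrightarrow> v \<in> B' i \<Longrightarrow> i \<noteq> m' \<Longrightarrow> 0 < i \<and> v \<in> B' (p' i)"
          using top'[of v] sub'[OF vi(1)] vi(2) by blast
        \<comment> \<open>Node \<open>0\<close> of the second tree holds \<open>v\<close> and cannot
          satisfy \<open>0 < 0\<close>, so it is the exceptional node and every other node holding
          \<open>v\<close> passes it upward.\<close>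
        have "m' = 0" using m'[of 0] n vXY(2) B0 by blast
        then have "v \<in> B' (p' (i - n))" using m'[OF vi] False \<open>\<not> i < n\<close> by simp
        then show ?thesis using False \<open>\<not> i < n\<close> by simp
      qed
    qed
    then show ?thesis using m(1,2) by (intro exI[of _ m]) simp
  next
    case False
    then obtain m where m: "m < n'" "v \<in> B' m" "\<And>i. i < n' \<Longrightarrow> v \<in> B' i \<Longrightarrow> i \<noteq> m \<Longrightarrow> 0 < i \<and> v \<in> B' (p' i)"
      using top'[of v] v by blast
    have "0 < i \<and> v \<in> ?B (?p i)" if i: "i < ?n" "v \<in> ?B i" "i \<noteq> n + m" for i
    proof -
      have ni: "\<not> i < n" using i(2) sub[of i] False by auto
      then have "0 < i - n \<and> v \<in> B' (p' (i - n))" using m(3)[of "i - n"] diff[of i] i by auto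
      then show ?thesis using ni by auto
    qed
    then show ?thesis using m(1,2) by (intro exI[of _ "n + m"]) simp
  qed
  have c5: "\<exists>i<?n. a \<in> ?B i \<and> b \<in> ?B i" if ab: "a \<in> W \<union> W'" "b \<in> W \<union> W'" "E a b" for a b
  proof -
    consider "a \<in> W" "b \<in> W" | "a \<in> W'" "b \<in> W'"
      using ab cross[of a b] cross[of b a] sym[of a b] by blast
    then show ?thesis
    proof cases
      case 1
      then obtain i where "i < n" "a \<in> B i" "b \<in> B i" using edge ab(3) by blast
      then show ?thesis by (intro exI[of _ i]) auto
    next
      case 2
      then obtain i where "i < n'" "a \<in> B' i" "b \<in> B' i" using edge' ab(3) by blast
      then show ?thesis by (intro exI[of _ "n + i"]) auto
    qed
  qed
  have right: "n \<le> j \<and> (i - n, j - n) \<in> (parent_arcs n' p')\<^sup>*" if "(i, j) \<in> (parent_arcs ?n ?p)\<^sup>*" "n \<le> i" for i j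
    using that
  proof (induction rule: rtrancl_induct)
    case (step y z)
    then have yz: "y = ?p z" "0 < z" "z < ?n" "n \<le> y" by (simp_all add: parent_arcs_iff)
    have "n < z" using yz p(1)[of z] by (auto split: if_splits)
    then have "(y - n, z - n) \<in> parent_arcs n' p'" using yz by (simp add: parent_arcs_iff)
    then show ?case using step \<open>n < z\<close> by (auto intro: rtrancl_into_rtrancl)
  qed simp
  \<comment> \<open>Only node \<open>0\<close> has a child in the second block, so a path from any
    other node of the first block stays there. Paths from \<open>0\<close> are handled by the
    hypothesis on \<open>X\<close>.\<close>
  have left: "j < n \<and> 0 < j \<and> (i, j) \<in> (parent_arcs n p)\<^sup>*" if "(i, j) \<in> (parent_arcs ?n ?p)\<^sup>*" "0 < i" "i < n" for i j
    using that
  proof (induction rule: rtrancl_induct)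
    case (step y z)
    then have yz: "y = ?p z" "0 < z" "z < ?n" "y < n" "0 < y" by (simp_all add: parent_arcs_iff)
    then have "z < n" by (auto split: if_splits)
    then have "(y, z) \<in> parent_arcs n p" using yz by (simp add: parent_arcs_iff)
    then show ?case using step \<open>z < n\<close> yz by (auto intro: rtrancl_into_rtrancl)
  qed simp
  have c6: "d x \<le> d r" if ij: "i < ?n" "j < ?n" "(i, j) \<in> (parent_arcs ?n ?p)\<^sup>*" "x \<in> ?B i" "r \<in> ?B j - ?B i"
    for i j x r
  proof -
    consider "i = 0" | "0 < i" "i < n" | "n \<le> i" by linarith
    then show ?thesis
    proof cases
      case 1
      then have x: "x \<in> X" "r \<notin> X" using ij n B0 by auto
      show ?thesis
      proof (cases "j < n")
        case True
        then show ?thesis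
          using strat[of 0 j x r] root_reaches[OF p(1) True] ij(5) x n(1) B0 by simp
      next
        case False
        then have "r \<in> W'" using sub'[OF diff[of j]] ij by auto
        then show ?thesis using d x by blast
      qed
    next
      case 2
      then show ?thesis using strat[of i j x r] left[OF ij(3) 2] ij by simp
    next
      case 3
      then show ?thesis using strat'[of "i - n" "j - n" x r] right[OF ij(3) 3] diff[of i] diff[of j] ij by auto
    qed
  qed
  show ?thesis
  proof (rule array_decompI)
    show "0 < ?n" using n by simp
    show "?B 0 = X" using n B0 by simp
  qed (fact c1 c2 c3 c4 c5 c6)+
qed

lemma strat_decomp_array:
  assumes "strat_decomp E d k X W" and sym: "\<And>a b. E a b \<Longrightarrow> E b a"
  shows "\<exists>n p B. array_decomp E d k X W n p B"
  using assms(1)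
proof (induction rule: strat_decomp.induct)
  case (leaf X)
  then have "array_decomp E d k X X 1 id (\<lambda>_. X)" by (intro array_decompI) auto
  then show ?case by blast
next
  case (attach X W Y W')
  then obtain n p B n' p' B' where
    "array_decomp E d k X W n p B" "array_decomp E d k Y W' n' p' B'" by blast
  from array_decomp_attach[OF this attach.hyps(3-6) sym] show ?case by blast
qed

theorem strat_decomp_tree_decomposition:
  assumes G: "pair_graph G" and "strat_decomp (adj G) d k X (pverts G)"
  shows "\<exists>(T :: nat pair_pre_digraph) r B. tree_decomposition G T r B \<and>
    stratified_decomposition G d T B \<and> (\<forall>t \<in> pverts T. card (B t) \<le> k)"
proof -
  obtain n p B where A: "array_decomp (adj G) d k X (pverts G) n p B"
    using strat_decomp_array[OF assms(2) pair_graph_sym[OF G]] by blast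
  define T where "T = parent_tree n p"
  have verts: "pverts T = {..<n}" and arcs: "parcs T = parent_arcs n p"
    unfolding T_def parent_tree_def by simp_all
  note n = array_decompD(1)[OF A] and p = array_decompD(2)[OF A]
    and W = array_decompD(4)[OF A] and card = array_decompD(5)[OF A]
  have td: "tree_decomposition G T 0 B"
    unfolding tree_decomposition_def
  proof (intro conjI ballI)
    show "rooted_tree T 0" unfolding T_def by (rule parent_tree_rooted[OF n p])
    show "B t \<subseteq> pverts G" if "t \<in> pverts T" for t using that W unfolding verts by blast
    show "\<exists>t \<in> pverts T. v \<in> B t" if "v \<in> pverts G" for v using that W unfolding verts by blast
    show "case e of (u, v) \<Rightarrow> \<exists>t \<in> pverts T. u \<in> B t \<and> v \<in> B t" if "e \<in> parcs G" for e
    proof -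
      obtain u v where e: "e = (u, v)" by (cases e)
      then have "u \<in> pverts G" "v \<in> pverts G" "(u, v) \<in> parcs G" using that pair_graph_verts[OF G] by blast+
      then have "\<exists>i<n. u \<in> B i \<and> v \<in> B i" by (rule array_decompD(7)[OF A])
      then show ?thesis unfolding e verts by auto
    qed
    show "Digraph_Component.connected (with_proj T \<restriction> {t \<in> pverts T. v \<in> B t})" if "v \<in> pverts G" for v
    proof -
      obtain m where m: "m < n" "v \<in> B m" "\<And>i. i < n \<Longrightarrow> v \<in> B i \<Longrightarrow> i \<noteq> m \<Longrightarrow> 0 < i \<and> v \<in> B (p i)"
        using array_decompD(6)[OF A \<open>v \<in> pverts G\<close>] by blast
      show ?thesis
        unfolding T_def
      proof (rule parent_tree_connected[OF _ _ p])
        show "{t \<in> pverts (parent_tree n p). v \<in> B t} \<subseteq> {..<n}" unfolding parent_tree_def by auto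
        show "m \<in> {t \<in> pverts (parent_tree n p). v \<in> B t}" using m unfolding parent_tree_def by simp
        show "0 < i \<and> p i \<in> {t \<in> pverts (parent_tree n p). v \<in> B t}"
          if "i \<in> {t \<in> pverts (parent_tree n p). v \<in> B t}" "i \<noteq> m" for i
        proof -
          have i: "i < n" "v \<in> B i" using that unfolding parent_tree_def by simp_all
          from m(3)[OF this that(2)] show ?thesis using p[of i] i unfolding parent_tree_def by simp
        qed
      qed
    qed
  qed
  interpret decomposition_tree G T 0 B by unfold_locales (rule td)
  have "stratified_decomposition G d T B"
    unfolding stratified_decomposition_def
  proof (intro ballI impI)
    fix u v assume uv: "u \<in> pverts G" "v \<in> pverts G" "tree_less T (top_node T B u) (top_node T B v)"
    let ?s = "top_node T B u" and ?t = "top_node T B v"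
    have st: "?s \<rightarrow>\<^sup>*\<^bsub>T\<^esub> ?t" "?s \<noteq> ?t" using uv(3) unfolding tree_less_def by blast+
    \<comment> \<open>Otherwise the top node of \<open>v\<close> would also reach \<open>?s\<close>,
      and the two top nodes would coincide.\<close>
    have "v \<notin> B ?s"
      using reachable_antisym[OF st(1)] top_node_least[OF uv(2) top_node(1)[OF uv(1)]] st(2) by blast
    moreover have "(?s, ?t) \<in> (parent_arcs n p)\<^sup>*" using reachable_rtranclI[OF st(1)] by (simp add: arcs)
    moreover have "?s < n" "?t < n" using top_node(1) uv(1,2) unfolding verts by auto
    ultimately show "d u \<le> d v"
      using array_decompD(8)[OF A, of ?s ?t u v] top_node(2)[OF uv(1)] top_node(2)[OF uv(2)] by blast
  qed
  moreover have "\<forall>t \<in> pverts T. card (B t) \<le> k" using card unfolding verts by simp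
  ultimately show ?thesis using td by blast
qed

subsection \<open>The three parameters\<close>

text \<open>Common yardstick of the three parameters: it counts bag sizes, on a par with cops, which
  confines the shift by one to \<open>tw\<close>.\<close>

definition has_strat_tree :: "'a pair_pre_digraph \<Rightarrow> ('a \<Rightarrow> nat) \<Rightarrow> nat \<Rightarrow> bool" where
  "has_strat_tree G d k \<longleftrightarrow> (\<exists>(T :: nat pair_pre_digraph) r B. tree_decomposition G T r B \<and>
     stratified_decomposition G d T B \<and> (\<forall>t \<in> pverts T. card (B t) \<le> k))"

lemma strat_tree_imp_monotone:
  assumes "has_strat_tree G d k"
  shows "\<exists>\<sigma>. winning_strategy G d k \<sigma> \<and> monotone_strategy G \<sigma>"
proof -
  obtain T :: "nat pair_pre_digraph" and r B where td: "tree_decomposition G T r B"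
    "stratified_decomposition G d T B" "\<And>t. t \<in> pverts T \<Longrightarrow> card (B t) \<le> k"
    using assms unfolding has_strat_tree_def by blast
  interpret decomposition_tree G T r B by unfold_locales (rule td(1))
  interpret S: search_tree G d k "pverts T" r "\<lambda>t t'. (t, t') \<in> parcs T" B verts_below
    by (rule search_tree[OF td(2,3)])
  show ?thesis using S.chase_wins by blast
qed

text \<open>Any winning strategy bounds the bramble covers of all torsos, and duality supplies the
  trees. Followed by the chase, this turns an arbitrary winning strategy into a monotone one with as
  many cops.\<close>

lemma winning_imp_strat_tree:
  assumes G: "pair_graph G" and win: "winning_strategy G d k \<sigma>"
  shows "has_strat_tree G d k"
proof -
  note sym = pair_graph_sym[OF G]
  have "strat_decomp (adj G) d k {} (pverts G)"
  proof (rule strat_decomp_from_torsos)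
    show "finite (pverts G)" by (rule pair_graph_finite[OF G])
    fix C assume C: "C \<subseteq> pverts G" "upper_part (adj G) d C"
    show "\<exists>F X. decomp (torso (adj G) d C) F X (torso_verts (adj G) d C) \<and> (\<forall>S \<in> F. card S \<le> k)"
    proof (rule treewidth_duality)
      have "torso_verts (adj G) d C \<subseteq> pverts G"
        using C(1) pair_graph_verts[OF G] unfolding torso_verts_def neighbours_def by blast
      then show "finite (torso_verts (adj G) d C)" using pair_graph_finite[OF G] finite_subset by blast
      show "torso (adj G) d C b a" if "torso (adj G) d C a b" for a b
        using torso_sym[of "adj G" d C a b] sym that by blast
      show "\<exists>X \<subseteq> torso_verts (adj G) d C. covers X \<B> \<and> card X \<le> k"
        if "bramble (torso (adj G) d C) (torso_verts (adj G) d C) \<B>" for \<B>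
        by (rule winning_cops_cover_bramble[OF G C that win])
    qed
  qed (use sym pair_graph_verts[OF G] in blast)+
  then show ?thesis
    unfolding has_strat_tree_def by (rule strat_decomp_tree_decomposition[OF G])
qed

text \<open>A single bag holding every vertex. It ensures that the minima in \<open>cw\<close>,
  \<open>moncw\<close> and \<open>tw\<close> are attained.\<close>

lemma has_strat_tree_card:
  assumes "pair_graph G"
  shows "has_strat_tree G d (card (pverts G))"
  unfolding has_strat_tree_def
  by (rule strat_decomp_tree_decomposition[OF assms strat_decomp.leaf[OF order_refl]])

lemma winning_strategy_mono: "winning_strategy G d k \<sigma> \<Longrightarrow> k \<le> l \<Longrightarrow> winning_strategy G d l \<sigma>"
  unfolding winning_strategy_def strategy_for_def using le_trans by blast

lemma Least_le_iff:
  fixes P :: "nat \<Rightarrow> bool"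
  assumes "P m" "\<And>k l. P k \<Longrightarrow> k \<le> l \<Longrightarrow> P l"
  shows "(LEAST k. P k) \<le> k \<longleftrightarrow> P k"
  using LeastI[of P, OF assms(1)] Least_le[of P k] assms(2) by blast

lemma cw_le_iff:
  assumes "pair_graph G"
  shows "cw G d \<le> k \<longleftrightarrow> has_strat_tree G d k"
proof -
  have iff: "(\<exists>\<sigma>. winning_strategy G d k \<sigma>) \<longleftrightarrow> has_strat_tree G d k" for k
    using winning_imp_strat_tree[OF assms] strat_tree_imp_monotone by blast
  have "(LEAST k. \<exists>\<sigma>. winning_strategy G d k \<sigma>) \<le> k \<longleftrightarrow> (\<exists>\<sigma>. winning_strategy G d k \<sigma>)"
    by (rule Least_le_iff[of _ "card (pverts G)"])
      (use iff has_strat_tree_card[OF assms] winning_strategy_mono in blast)+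
  then show ?thesis unfolding cw_def iff .
qed

lemma moncw_le_iff:
  assumes "pair_graph G"
  shows "moncw G d \<le> k \<longleftrightarrow> has_strat_tree G d k"
proof -
  have iff: "(\<exists>\<sigma>. winning_strategy G d k \<sigma> \<and> monotone_strategy G \<sigma>) \<longleftrightarrow> has_strat_tree G d k" for k
    using winning_imp_strat_tree[OF assms] strat_tree_imp_monotone by blast
  have "(LEAST k. \<exists>\<sigma>. winning_strategy G d k \<sigma> \<and> monotone_strategy G \<sigma>) \<le> k \<longleftrightarrow>
      (\<exists>\<sigma>. winning_strategy G d k \<sigma> \<and> monotone_strategy G \<sigma>)"
    by (rule Least_le_iff[of _ "card (pverts G)"])
      (use iff has_strat_tree_card[OF assms] winning_strategy_mono in blast)+
  then show ?thesis unfolding moncw_def iff .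
qed

lemma width_le_iff:
  assumes "tree_decomposition G T r B"
  shows "width T B \<le> int k - 1 \<longleftrightarrow> (\<forall>t \<in> pverts T. card (B t) \<le> k)"
proof -
  interpret decomposition_tree G T r B by unfold_locales (rule assms)
  have "finite (pverts T)" "pverts T \<noteq> {}" using pair_finite_verts root_node by auto
  then have "Max ((\<lambda>t. card (B t)) ` pverts T) \<le> k \<longleftrightarrow> (\<forall>t \<in> pverts T. card (B t) \<le> k)" by simp
  then show ?thesis unfolding width_def by linarith
qed

lemma tw_le_iff:
  assumes "pair_graph G"
  shows "tw G d \<le> int k - 1 \<longleftrightarrow> has_strat_tree G d k" and tw_ge: "- 1 \<le> tw G d"
proof -
  define P where "P w \<longleftrightarrow> (\<exists>(T :: nat pair_pre_digraph) r B. tree_decomposition G T r B \<and>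
    stratified_decomposition G d T B \<and> width T B = w)" for w
  have ge: "- 1 \<le> w" if "P w" for w using that unfolding P_def width_def by auto
  have iff: "(\<exists>w \<le> int k - 1. P w) \<longleftrightarrow> has_strat_tree G d k" for k
    unfolding P_def has_strat_tree_def using width_le_iff by metis
  obtain w0 where "P w0" using iff[of "card (pverts G)"] has_strat_tree_card[OF assms] by blast
  \<comment> \<open>The integers are not well-founded, but by \<open>ge\<close> adding one maps
    widths faithfully into the naturals, where a minimum exists.\<close>
  then obtain w where w: "P w" "\<And>v. P v \<Longrightarrow> nat (w + 1) \<le> nat (v + 1)"
    using ex_has_least_nat[of P w0 "\<lambda>w. nat (w + 1)"] by blast
  have le: "w \<le> v" if "P v" for v using w(2)[OF that] ge[OF w(1)] ge[OF that] by simp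
  have tw: "tw G d = w" unfolding tw_def P_def[symmetric] by (rule Least_equality[of P, OF w(1) le])
  show "- 1 \<le> tw G d" using ge[OF w(1)] tw by simp
  show "tw G d \<le> int k - 1 \<longleftrightarrow> has_strat_tree G d k"
    unfolding tw iff[symmetric] using w(1) le order_trans by blast
qed

section \<open>Application to the graph of a formula\<close>

lemma finite_vars: "finite (vars \<phi>)"
proof -
  have "finite (atom_vars a)" for a :: "('r, 'v) atom" by (cases a) auto
  then show ?thesis by (induction \<phi>) auto
qed

lemma free_vars_subset: "free_vars \<phi> \<subseteq> vars \<phi>"
  by (induction \<phi>) auto

lemma occs_vars: "(p, \<chi>) \<in> occs \<phi> \<Longrightarrow> vars \<chi> \<subseteq> vars \<phi>"
  by (induction \<phi> arbitrary: p) fastforce+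

lemma atom_vars_subset: "a \<in> atoms \<phi> \<Longrightarrow> atom_vars a \<subseteq> vars \<phi>"
  unfolding atoms_def using occs_vars by fastforce

lemma pair_graph_formula_graph: "pair_graph (formula_graph \<phi>)"
proof
  have sub: "parcs (formula_graph \<phi>) \<subseteq> vars \<phi> \<times> vars \<phi>"
    unfolding formula_graph_def using free_vars_subset[of \<phi>] atom_vars_subset[of _ \<phi>] by auto
  have verts: "pverts (formula_graph \<phi>) = vars \<phi>" unfolding formula_graph_def by simp
  show "fst e \<in> pverts (formula_graph \<phi>)" "snd e \<in> pverts (formula_graph \<phi>)"
    if "e \<in> parcs (formula_graph \<phi>)" for e
    using sub that unfolding verts by auto
  show "finite (pverts (formula_graph \<phi>))" unfolding verts by (rule finite_vars)
  show "finite (parcs (formula_graph \<phi>))" using finite_subset[OF sub] finite_vars by blast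
  show "fst e \<noteq> snd e" if "e \<in> parcs (formula_graph \<phi>)" for e
    using that unfolding formula_graph_def by auto
  show "symmetric (formula_graph \<phi>)"
    unfolding symmetric_def by (rule symI) (auto simp: formula_graph_def)
qed

theorem theorem6p8:
  fixes G :: "'a pair_pre_digraph" and d :: "'a \<Rightarrow> nat" and k :: nat
    and \<phi> :: "('r, 'v) fm"
  shows "(pair_graph G \<and> k \<ge> 1 \<longrightarrow>
            (tw G d \<le> int k - 1 \<longleftrightarrow> moncw G d \<le> k) \<and>
            (moncw G d \<le> k \<longleftrightarrow> cw G d \<le> k))
       \<and> (straight \<phi> \<longrightarrow>
            fotw \<phi> + 1 = int (moncw (formula_graph \<phi>) (ead \<phi>)) \<and>
            moncw (formula_graph \<phi>) (ead \<phi>) = cw (formula_graph \<phi>) (ead \<phi>))"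
proof (intro conjI impI)
  assume "pair_graph G \<and> k \<ge> 1"
  then show "tw G d \<le> int k - 1 \<longleftrightarrow> moncw G d \<le> k" "moncw G d \<le> k \<longleftrightarrow> cw G d \<le> k"
    using tw_le_iff moncw_le_iff cw_le_iff by blast+
next
  let ?G = "formula_graph \<phi>" and ?d = "ead \<phi>"
  note G = pair_graph_formula_graph[of \<phi>]
  have mon: "moncw ?G ?d \<le> l \<longleftrightarrow> cw ?G ?d \<le> l" for l
    using moncw_le_iff[OF G] cw_le_iff[OF G] by blast
  show "moncw ?G ?d = cw ?G ?d"
    using mon[of "cw ?G ?d"] mon[of "moncw ?G ?d"] by simp
  have "tw ?G ?d \<le> int l - 1 \<longleftrightarrow> moncw ?G ?d \<le> l" for l
    using tw_le_iff[OF G] moncw_le_iff[OF G] by blast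
  \<comment> \<open>The first instance bounds \<open>tw\<close> from above, the second from below;
    \<open>tw_ge\<close> guarantees that \<open>nat\<close> does not truncate, even at width
    \<open>-1\<close>.\<close>
  from this[of "moncw ?G ?d"] this[of "nat (tw ?G ?d + 1)"] tw_ge[OF G, of ?d]
  show "fotw \<phi> + 1 = int (moncw ?G ?d)" unfolding fotw_def by simp
qed

end
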